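(* Let $\alpha_1>\alpha_0\ge0$ be constants, let $t\in[0,1]$ and $\mathbf{U},\mathbf{V}\in\mathbb{R}^N$. Define $$\Psi_{(t,\mathbf{U})}(\mathbf{x})=\big(\alpha_0|t\mathbf{x}+\mathbf{U}|^2(t\mathbf{x}+\mathbf{U})+\alpha_1|(1-t)\mathbf{x}-\mathbf{U}|^2((1-t)\mathbf{x}-\mathbf{U})\big)\cdot\mathbf{x},\qquad \mathbf{x}\in\mathbb{R}^N,$$ the map $\Phi_{(t,\mathbf{U})}:\mathbb{R}^N\to\mathbb{R}^N$, $$\Phi_{(t,\mathbf{U})}(\mathbf{x})=t\alpha_1|\mathbf{U}-(1-t)\mathbf{x}|^2(\mathbf{U}-(1-t)\mathbf{x})+(1-t)\alpha_0|\mathbf{U}+t\mathbf{x}|^2(\mathbf{U}+t\mathbf{x}),$$ and the set $$\mathbf{C}(t,\mathbf{U})=\{\mathbf{x}\in\mathbb{R}^N:\Psi_{(t,\mathbf{U})}(\mathbf{x})\le0\}.$$ Then the triplet $(t,\mathbf{U},\mathbf{V})$ is reachable by lamination if and only if $\mathbf{V}\in\Phi_{(t,\mathbf{U})}(\mathbf{C}(t,\mathbf{U}))$.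
   Context: For $i=1,0$ let $\Lambda_i=\{(\mathbf{u},\mathbf{v})\in\mathbb{R}^N\times\mathbb{R}^N:\mathbf{v}=\alpha_i|\mathbf{u}|^2\mathbf{u}\}$. Laminates (for the constraints $\operatorname{curl}\mathbf{U}=0$, $\operatorname{div}\mathbf{V}=0$) are the finitely supported probability measures on $\mathbb{R}^N\times\mathbb{R}^N$ defined recursively: a Dirac mass is a laminate of order $0$; and if $\nu_1,\nu_0$ are laminates of order at most $k$ with barycenters (first moments) $(\mathbf{A}_1,\mathbf{B}_1)$ and $(\mathbf{A}_0,\mathbf{B}_0)$ satisfying $(\mathbf{A}_1-\mathbf{A}_0)\cdot(\mathbf{B}_1-\mathbf{B}_0)=0$, then $r\nu_1+(1-r)\nu_0$, for any $r\in[0,1]$, is a laminate of order at most $k+1$. A triplet $(t,\mathbf{U},\mathbf{V})\in[0,1]\times\mathbb{R}^N\times\mathbb{R}^N$ is reachable by lamination if there is a laminate $\nu$ (of some finite order) with barycenter $(\mathbf{U},\mathbf{V})$ that can be written as $\nu=t\nu^{(1)}+(1-t)\nu^{(0)}$, where $\nu^{(i)}$ is a probability measure supported in $\Lambda_i$, $i=1,0$. *)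

theory Defs
  imports "HOL-Analysis.Analysis" "HOL-Probability.Probability_Mass_Function"
begin

definition constitutive_set :: "real \<Rightarrow> ((real ^ 'n) \<times> (real ^ 'n)) set" where
  "constitutive_set \<alpha> = {(u, v). v = (\<alpha> * (norm u)\<^sup>2) *\<^sub>R u}"

text \<open>
  Finitely supported probability measures are represented by probability mass functions;
  all laminates have finite support, see \<open>finite_set_pmf_laminate\<close> below.
  The mixture is the convex combination of measures, see \<open>pmf_mixture\<close>; it is meaningful only for
  weights in the unit interval, because the parameter of \<^const>\<open>bernoulli_pmf\<close> is clamped
  to that interval.
\<close>

definition mixture :: "real \<Rightarrow> 'a pmf \<Rightarrow> 'a pmf \<Rightarrow> 'a pmf" where
  "mixture r \<mu> \<nu> = bind_pmf (bernoulli_pmf r) (\<lambda>b. if b then \<mu> else \<nu>)"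

lemma pmf_mixture:
  assumes "0 \<le> r" "r \<le> 1"
  shows "pmf (mixture r \<mu> \<nu>) z = r * pmf \<mu> z + (1 - r) * pmf \<nu> z"
  using assms by (simp add: mixture_def pmf_bind)

definition barycenter ::
    "('a::{banach, second_countable_topology}) pmf \<Rightarrow> 'a" where
  "barycenter \<nu> = measure_pmf.expectation \<nu> (\<lambda>z. z)"

text \<open>
  \<open>laminate k \<nu>\<close> means that \<open>\<nu>\<close> is a laminate of order at most \<open>k\<close>. The predicate is monotone
  in \<open>k\<close>, because both components of a mixture may be equal.
\<close>

inductive laminate :: "nat \<Rightarrow> ((real ^ 'n) \<times> (real ^ 'n)) pmf \<Rightarrow> bool" where
  dirac: "laminate 0 (return_pmf z)"
| mix: "\<lbrakk>laminate k \<nu>1; laminate k \<nu>0;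
         barycenter \<nu>1 = (A1, B1); barycenter \<nu>0 = (A0, B0);
         (A1 - A0) \<bullet> (B1 - B0) = 0; 0 \<le> r; r \<le> 1\<rbrakk>
        \<Longrightarrow> laminate (Suc k) (mixture r \<nu>1 \<nu>0)"

lemma finite_set_pmf_laminate: "laminate k \<nu> \<Longrightarrow> finite (set_pmf \<nu>)"
  by (induction rule: laminate.induct) (auto simp: mixture_def)

definition reachable_by_lamination ::
    "real \<Rightarrow> real \<Rightarrow> real \<Rightarrow> real ^ 'n \<Rightarrow> real ^ 'n \<Rightarrow> bool" where
  "reachable_by_lamination \<alpha>1 \<alpha>0 t U V \<longleftrightarrow>
     0 \<le> t \<and> t \<le> 1 \<and>
     (\<exists>\<nu> k. laminate k \<nu> \<and> barycenter \<nu> = (U, V) \<and>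
        (\<exists>\<nu>1 \<nu>0. set_pmf \<nu>1 \<subseteq> constitutive_set \<alpha>1 \<and>
                  set_pmf \<nu>0 \<subseteq> constitutive_set \<alpha>0 \<and>
                  \<nu> = mixture t \<nu>1 \<nu>0))"

definition \<Psi> :: "real \<Rightarrow> real \<Rightarrow> real \<Rightarrow> real ^ 'n \<Rightarrow> real ^ 'n \<Rightarrow> real" where
  "\<Psi> \<alpha>1 \<alpha>0 t U x =
     ((\<alpha>0 * (norm (t *\<^sub>R x + U))\<^sup>2) *\<^sub>R (t *\<^sub>R x + U)
      + (\<alpha>1 * (norm ((1 - t) *\<^sub>R x - U))\<^sup>2) *\<^sub>R ((1 - t) *\<^sub>R x - U)) \<bullet> x"

definition \<Phi> :: "real \<Rightarrow> real \<Rightarrow> real \<Rightarrow> real ^ 'n \<Rightarrow> real ^ 'n \<Rightarrow> real ^ 'n" where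
  "\<Phi> \<alpha>1 \<alpha>0 t U x =
     (t * \<alpha>1 * (norm (U - (1 - t) *\<^sub>R x))\<^sup>2) *\<^sub>R (U - (1 - t) *\<^sub>R x)
     + ((1 - t) * \<alpha>0 * (norm (U + t *\<^sub>R x))\<^sup>2) *\<^sub>R (U + t *\<^sub>R x)"

definition C_set :: "real \<Rightarrow> real \<Rightarrow> real \<Rightarrow> real ^ 'n \<Rightarrow> (real ^ 'n) set" where
  "C_set \<alpha>1 \<alpha>0 t U = {x. \<Psi> \<alpha>1 \<alpha>0 t U x \<le> 0}"

end

theory Submission
  imports Defs
begin

text \<open>
  Write \<open>cube u = |u|\<^sup>2 u\<close>, \<open>w1 = U - (1 - t) x\<close> and \<open>w0 = U + t x\<close>, so that \<open>x\<close> parametrizes the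
  pairs of constant fields in the two phases with mean \<open>U\<close>; put \<open>vi = \<alpha>i cube wi\<close>. Then
  \<open>\<Phi> x = t v1 + (1 - t) v0\<close> is the mean flux and \<open>\<Psi> x = (v1 - v0) \<bullet> (w1 - w0)\<close>. Let \<open>K\<close> be the image
  under \<open>\<Phi>\<close> of the set where \<open>\<Psi> \<le> 0\<close>. The extreme values \<open>t = 0\<close>, \<open>t = 1\<close> and the case \<open>U = 0\<close> only
  need the strict monotonicity of \<open>cube\<close> (\<open>phase_rigidity\<close>); let \<open>0 < t < 1\<close> and \<open>U \<noteq> 0\<close>.

  Both directions rest on one algebraic fact (\<open>pencil_bijective\<close>): where \<open>\<Psi> < 0\<close>, the derivative of \<open>\<Phi>\<close>,
  which is \<open>- t (1 - t)\<close> times \<open>\<alpha>1 cube_deriv w1 - \<alpha>0 cube_deriv w0\<close>, is invertible. Hence \<open>\<Phi>\<close> is open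
  there, and every frontier point of the compact set \<open>K\<close> is \<open>\<Phi> y\<close> for some \<open>y\<close> with \<open>\<Psi> y = 0\<close>
  (\<open>frontier_\<Phi>_image\<close>).

  Sufficiency. If \<open>\<Psi> y = 0\<close>, the two Dirac masses at \<open>(w1, v1)\<close> and \<open>(w0, v0)\<close> are compatible, and \<open>\<Phi> y\<close> is
  reached by a laminate of order one. A line through an interior point of \<open>K\<close> meets the frontier of \<open>K\<close> on
  both sides, and the two laminates found there have the same first moment \<open>U\<close>, so they are compatible
  with each other: laminates of order two suffice.

  Necessity. Along a laminate the expectation of \<open>u \<bullet> v\<close> is \<open>U \<bullet> V\<close> (\<open>laminate_div_curl\<close>), while in phase \<open>i\<close>
  the product \<open>u \<bullet> v\<close> equals \<open>\<alpha>i |u|\<^sup>4\<close>. At a pair with \<open>\<Psi> y = 0\<close> there is a single linear form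
  \<open>\<kappa> \<bullet> u + \<mu> \<bullet> v\<close> which on both constitutive sets, up to an additive constant for each phase, lies below \<open>u \<bullet> v\<close>
  and touches it at \<open>(wi, vi)\<close> (\<open>dual_certificate\<close>). Taking expectations, the defect \<open>E (u \<bullet> v) - U \<bullet> V\<close> of any
  mixture of two measures on the two constitutive sets with barycenter \<open>(U, V)\<close> dominates an affine function of
  \<open>V\<close> that vanishes at \<open>\<Phi> y\<close>. A laminate has defect zero; the pair of constant fields given by \<open>x\<close> has flux \<open>\<Phi> x\<close>
  and a negative defect if \<open>\<Psi> x < 0\<close> (\<open>energy_gap\<close>). A segment from such a \<open>\<Phi> x\<close> to a reachable \<open>V\<close> outside \<open>K\<close>
  would cross the frontier of \<open>K\<close> at some \<open>\<Phi> y\<close> with \<open>\<Psi> y = 0\<close>, so the affine function would be negative at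
  one end, nonpositive at the other and zero before the second end, which is impossible.

  The existence of \<open>\<kappa>\<close> and \<open>\<mu>\<close> is the core. Stationarity at \<open>w1\<close> and \<open>w0\<close> forces \<open>\<mu>\<close> to solve the linear system
  \<open>\<alpha>1 cube_deriv w1 \<mu> - \<alpha>0 cube_deriv w0 \<mu> = 4 (v1 - v0)\<close>, and the touching is global as soon as
  \<open>|\<mu>|\<^sup>2 + 4 \<mu> \<bullet> wi \<le> 8 |wi|\<^sup>2\<close> (\<open>quartic_contact\<close>). With \<open>p = w1\<close>, \<open>q = k w0\<close>, \<open>k\<^sup>3 = \<alpha>0 / \<alpha>1\<close> these two
  inequalities involve only \<open>k\<close> and the Gram matrix of \<open>p\<close> and \<open>q\<close>, and they become sums of squares
  (\<open>multiplier_bounds_normalized\<close>).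
\<close>

section \<open>The map \<open>u \<longmapsto> |u|\<^sup>2 u\<close>\<close>

definition cube :: "'a::real_inner \<Rightarrow> 'a" where
  "cube u = (norm u)\<^sup>2 *\<^sub>R u"

definition cube_deriv :: "'a::real_inner \<Rightarrow> 'a \<Rightarrow> 'a" where
  "cube_deriv w h = (norm w)\<^sup>2 *\<^sub>R h + (2 * (w \<bullet> h)) *\<^sub>R w"

lemma cube_zero [simp]: "cube 0 = 0"
  by (simp add: cube_def)

lemma cube_scaleR: "cube (k *\<^sub>R u) = k ^ 3 *\<^sub>R cube u"
  by (simp add: cube_def power_mult_distrib power2_eq_square power3_eq_cube)

lemma inner_cube_self: "u \<bullet> cube u = norm u ^ 4"
  by (simp add: cube_def dot_square_norm flip: power_add)

lemma norm_cube: "norm (cube u) = norm u ^ 3"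
  by (simp add: cube_def power2_eq_square power3_eq_cube)

lemma has_derivative_cube: "(cube has_derivative cube_deriv w) (at w)"
proof -
  have eq: "cube = (\<lambda>u::'a. (u \<bullet> u) *\<^sub>R u)" by (simp add: cube_def power2_norm_eq_inner fun_eq_iff)
  show ?thesis unfolding eq
    by (auto intro!: derivative_eq_intros
        simp: fun_eq_iff cube_deriv_def power2_norm_eq_inner inner_commute)
qed

lemma linear_cube_deriv: "linear (cube_deriv w)"
  by (rule linearI) (simp_all add: cube_deriv_def inner_add_right algebra_simps)

text \<open>
  With \<open>s = |a|\<^sup>2 + |b|\<^sup>2\<close>, the right-hand side is \<open>s |a - b|\<^sup>2 / 2 + (|a|\<^sup>2 - |b|\<^sup>2)\<^sup>2 / 2\<close>, and the
  parallelogram law gives \<open>|a - b|\<^sup>2 \<le> 2 s\<close>.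
\<close>

lemma cube_monotone: "norm (a - b) ^ 4 / 4 \<le> (cube a - cube b) \<bullet> (a - b)"
proof -
  define A where "A = a \<bullet> a"
  define B where "B = b \<bullet> b"
  define G where "G = a \<bullet> b"
  have n: "(norm (a - b))\<^sup>2 = A - 2 * G + B"
    unfolding A_def B_def G_def power2_norm_eq_inner by (simp add: inner_diff_left inner_diff_right inner_commute)
  have "0 \<le> (norm (a + b))\<^sup>2" by simp
  then have AB: "0 \<le> A + 2 * G + B"
    unfolding A_def B_def G_def power2_norm_eq_inner by (simp add: inner_add_left inner_add_right inner_commute)
  have nn: "0 \<le> A - 2 * G + B" using n zero_le_power2[of "norm (a - b)"] by linarith
  have l: "norm (a - b) ^ 4 = (A - 2 * G + B)\<^sup>2" unfolding n[symmetric] by (simp flip: power_mult)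
  have r: "(cube a - cube b) \<bullet> (a - b) = (A + B) * (A - 2 * G + B) / 2 + (A - B)\<^sup>2 / 2"
    unfolding A_def B_def G_def cube_def power2_norm_eq_inner
    by (simp add: inner_diff_left inner_diff_right inner_commute power2_eq_square field_simps)
  have "0 \<le> (A + 2 * G + B) * (A - 2 * G + B)" using AB nn by simp
  then have "(A - 2 * G + B)\<^sup>2 / 4 \<le> (A + B) * (A - 2 * G + B) / 2"
    by (simp add: power2_eq_square field_simps)
  then show ?thesis unfolding l r using zero_le_power2[of "A - B"] by linarith
qed

text \<open>
  The left-hand side has the same value and the same gradient at \<open>u = w\<close> as the right-hand side. With
  \<open>d = u - w\<close> and \<open>s = 2 w \<bullet> d + |d|\<^sup>2\<close>, right minus left is \<open>s\<^sup>2 - s (\<mu> \<bullet> d) + |d|\<^sup>2 (2 |w|\<^sup>2 - \<mu> \<bullet> w)\<close>, a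
  quadratic in \<open>s\<close> whose discriminant is nonpositive by Cauchy-Schwarz and the hypothesis.
\<close>

lemma quartic_contact:
  assumes "(norm \<mu>)\<^sup>2 + 4 * (\<mu> \<bullet> w) \<le> 8 * (norm w)\<^sup>2"
  shows "\<mu> \<bullet> (cube u - cube w) + (4 *\<^sub>R cube w - cube_deriv w \<mu>) \<bullet> (u - w) \<le> norm u ^ 4 - norm w ^ 4"
proof -
  define d where "d = u - w"
  have u: "u = w + d" by (simp add: d_def)
  define A where "A = w \<bullet> w"
  define B where "B = w \<bullet> d"
  define D where "D = d \<bullet> d"
  define m where "m = \<mu> \<bullet> w"
  define e where "e = \<mu> \<bullet> d"
  define M where "M = \<mu> \<bullet> \<mu>"
  have nu: "(norm u)\<^sup>2 = A + 2 * B + D"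
    unfolding u A_def B_def D_def power2_norm_eq_inner by (simp add: inner_add_left inner_add_right inner_commute)
  have nu4: "norm u ^ 4 = (A + 2 * B + D)\<^sup>2" unfolding nu[symmetric] by (simp flip: power_mult)
  have nw4: "norm w ^ 4 = A\<^sup>2" unfolding A_def power2_norm_eq_inner[symmetric] by (simp flip: power_mult)
  have M: "M + 4 * m \<le> 8 * A" using assms by (simp add: M_def m_def A_def power2_norm_eq_inner)
  have cs: "e\<^sup>2 \<le> M * D" unfolding e_def M_def D_def by (rule Cauchy_Schwarz_ineq)
  have D0: "0 \<le> D" by (simp add: D_def)
  have l: "\<mu> \<bullet> (cube u - cube w) + (4 *\<^sub>R cube w - cube_deriv w \<mu>) \<bullet> (u - w)
    = (A + 2 * B + D) * (m + e) - A * m + 4 * (A * B) - (A * e + 2 * m * B)"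
    unfolding cube_def nu d_def[symmetric] cube_deriv_def
    unfolding u A_def B_def m_def e_def power2_norm_eq_inner
    by (simp add: inner_add_left inner_add_right inner_diff_left inner_diff_right inner_commute algebra_simps)
  have "D * M \<le> D * (8 * A - 4 * m)" using M D0 by (intro mult_left_mono) auto
  then have "0 \<le> (2 * (2 * B + D) - e)\<^sup>2 + (D * (8 * A - 4 * m) - e\<^sup>2)"
    using cs by (intro add_nonneg_nonneg) (auto simp: mult.commute)
  also have "\<dots> = 4 * ((A + 2 * B + D)\<^sup>2 - A\<^sup>2 -
      ((A + 2 * B + D) * (m + e) - A * m + 4 * (A * B) - (A * e + 2 * m * B)))" by algebra
  finally show ?thesis unfolding l nu4 nw4 by simp
qed

section \<open>Inequalities for the Gram matrix of two fields\<close>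

text \<open>
  Here \<open>b\<close> and \<open>c\<close> stand for \<open>|q|\<^sup>2\<close> and \<open>p \<bullet> q\<close> when \<open>|p| = 1\<close>. Eliminating \<open>c\<close> between the two hypotheses leaves
  \<open>0 \<le> (b - k\<^sup>2) (1 - b\<^sup>3)\<close>, which determines both signs because \<open>k < 1\<close>. The last expression is the determinant of
  the linear system for \<open>p \<bullet> h\<close> and \<open>q \<bullet> h\<close> obtained from the equation
  \<open>cube_deriv p h - k cube_deriv q h = r\<close>; its positivity makes that system solvable.
\<close>

lemma gram_region:
  fixes b c k :: real
  assumes rel: "b\<^sup>2 + k \<le> c * (1 + k * b)" and cs: "c\<^sup>2 \<le> b" and k: "0 \<le> k" "k < 1"
  shows "k\<^sup>2 \<le> b" "b \<le> 1" "k * b < 1" "0 < (3 - k * b) * (1 - 3 * k * b) + 4 * k * c\<^sup>2"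
proof -
  have b0: "0 \<le> b" using cs zero_le_power2[of c] by linarith
  have "0 \<le> b\<^sup>2 + k" using k by simp
  then have sq: "(b\<^sup>2 + k)\<^sup>2 \<le> c\<^sup>2 * (1 + k * b)\<^sup>2"
    using power_mono[OF rel, of 2] by (simp add: power_mult_distrib)
  also have "\<dots> \<le> b * (1 + k * b)\<^sup>2" using cs by (intro mult_right_mono) auto
  finally have "0 \<le> b * (1 + k * b)\<^sup>2 - (b\<^sup>2 + k)\<^sup>2" by simp
  also have "\<dots> = (b - k\<^sup>2) * (1 - b ^ 3)" by algebra
  finally have pr: "0 \<le> (b - k\<^sup>2) * (1 - b ^ 3)" .
  have k2: "k\<^sup>2 < 1" using k by (simp add: power_less_one_iff)
  show kb2: "k\<^sup>2 \<le> b"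
  proof (rule ccontr)
    assume "\<not> ?thesis"
    then have "b < k\<^sup>2" by simp
    then have "1 \<le> b ^ 3" using pr by (simp add: zero_le_mult_iff)
    moreover have "b ^ 3 < 1" using \<open>b < k\<^sup>2\<close> k2 b0 by (simp add: power_less_one_iff)
    ultimately show False by simp
  qed
  show b1: "b \<le> 1"
  proof (rule ccontr)
    assume "\<not> ?thesis"
    then have "1 < b" by simp
    then have "1 < b ^ 3" by (simp add: one_less_power)
    then have "b \<le> k\<^sup>2" using pr by (simp add: zero_le_mult_iff)
    then show False using k2 \<open>1 < b\<close> by simp
  qed
  have "k * b \<le> k" using b1 k mult_left_mono[of b 1 k] by simp
  then show kb: "k * b < 1" using k by simp
  have z0: "0 \<le> k * b" using k b0 by simp
  have "0 < (1 - k * b)\<^sup>2 * (3 + 2 * (k * b) + 3 * (k * b)\<^sup>2) + 4 * k * (b\<^sup>2 - k)\<^sup>2"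
    using kb z0 k b0 by (intro add_pos_nonneg mult_pos_pos mult_nonneg_nonneg) auto
  also have "\<dots> = (3 - k * b) * (1 - 3 * k * b) * (1 + k * b)\<^sup>2 + 4 * k * (b\<^sup>2 + k)\<^sup>2"
    by algebra
  also have "\<dots> \<le> (3 - k * b) * (1 - 3 * k * b) * (1 + k * b)\<^sup>2 + 4 * k * (c\<^sup>2 * (1 + k * b)\<^sup>2)"
    using sq k by (intro add_left_mono mult_left_mono) auto
  also have "\<dots> = ((3 - k * b) * (1 - 3 * k * b) + 4 * k * c\<^sup>2) * (1 + k * b)\<^sup>2" by algebra
  finally show "0 < (3 - k * b) * (1 - 3 * k * b) + 4 * k * c\<^sup>2"
    by (simp add: zero_less_mult_iff)
qed

text \<open>
  The unknowns \<open>m1\<close>, \<open>m0\<close>, \<open>M\<close> stand for \<open>\<mu> \<bullet> p\<close>, \<open>\<mu> \<bullet> q\<close> and \<open>|\<mu>|\<^sup>2\<close> when \<open>|p| = 1\<close>; the three equations come from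
  the linear system for \<open>\<mu>\<close>, tested with \<open>p\<close>, \<open>q\<close> and \<open>\<mu>\<close>. Cramer's rule expresses the unknowns as rational
  functions of \<open>b\<close> and \<open>k\<close>, and the two differences to be estimated turn out to be, up to positive factors,
  sums of squares with the nonnegative weights \<open>X = b - k\<^sup>2\<close> and \<open>Y = 1 - b\<^sup>3\<close>. These weights are natural:
  \<open>X Y / (1 + k b)\<^sup>2\<close> is the Gram determinant \<open>b - c\<^sup>2\<close>.
\<close>

lemma multiplier_bounds_normalized:
  fixes b c k m1 m0 M :: real
  assumes rel: "c * (1 + k * b) = b\<^sup>2 + k"
    and e1: "(3 - k * b) * m1 - 2 * k * c * m0 = 4 * (1 - b * c)"
    and e2: "2 * c * m1 + (1 - 3 * k * b) * m0 = 4 * k * (1 - b * c)"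
    and e3: "(1 - k * b) * M = 4 * (m1 - b * m0) - 2 * m1\<^sup>2 + 2 * k * m0\<^sup>2"
    and k: "0 \<le> k" "k\<^sup>2 \<le> b" and b: "b \<le> 1" and kb: "k * b < 1"
  shows "M + 4 * m1 \<le> 8" "k\<^sup>2 * M + 4 * k * m0 \<le> 8 * b"
proof -
  \<comment> \<open>\<open>T\<close> is the determinant of the system for \<open>m1\<close> and \<open>m0\<close>, times \<open>(1 + k b)\<^sup>2\<close> to clear the
     denominator of \<open>c = (b\<^sup>2 + k) / (1 + k b)\<close>, written so that its sign is visible.\<close>
  define T where "T = (1 - k * b)\<^sup>2 * (3 + 2 * (k * b) + 3 * (k * b)\<^sup>2) + 4 * k * (b\<^sup>2 - k)\<^sup>2"
  define X where "X = b - k\<^sup>2"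
  define Y where "Y = 1 - b ^ 3"
  have b0: "0 \<le> b" using k(2) zero_le_power2[of k] by linarith
  have z0: "0 \<le> k * b" using k b0 by simp
  have X0: "0 \<le> X" and Y0: "0 \<le> Y" using k b b0 by (auto simp: X_def Y_def power_le_one)
  have T0: "0 < T" unfolding T_def using kb z0 k b0
    by (intro add_pos_nonneg mult_pos_pos mult_nonneg_nonneg) auto
  \<comment> \<open>The equations with \<open>c\<close> eliminated, and their solution.\<close>
  have bc: "(1 + k * b) * (1 - b * c) = Y" using rel unfolding Y_def by algebra
  have f1: "(3 - k * b) * (1 + k * b) * m1 - 2 * k * (b\<^sup>2 + k) * m0 = 4 * Y"
    using e1 rel bc by algebra
  have f2: "2 * (b\<^sup>2 + k) * m1 + (1 - 3 * k * b) * (1 + k * b) * m0 = 4 * k * Y"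
    using e2 rel bc by algebra
  define P where "P = 1 - 2 * (k * b) - (k * b)\<^sup>2 + 2 * k ^ 3"
  define Q where "Q = k + 2 * k * (k * b) - k * (k * b)\<^sup>2 - 2 * b\<^sup>2"
  have Tm1: "T * m1 = 4 * Y * P"
    using f1 f2 unfolding T_def P_def by algebra
  have Tm0: "T * m0 = 4 * Y * Q"
    using f1 f2 unfolding T_def Q_def by algebra
  have TM: "T\<^sup>2 * ((1 - k * b) * M)
     = 4 * T * (4 * Y * P - b * (4 * Y * Q)) - 2 * (4 * Y * P)\<^sup>2 + 2 * k * (4 * Y * Q)\<^sup>2"
    unfolding e3 Tm1[symmetric] Tm0[symmetric] by algebra
  have g1: "T\<^sup>2 * (1 - k * b) * (8 - 4 * m1 - M) = 8 * T\<^sup>2 * (1 - k * b) - 4 * T * (1 - k * b) * (4 * Y * P)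
     - (4 * T * (4 * Y * P - b * (4 * Y * Q)) - 2 * (4 * Y * P)\<^sup>2 + 2 * k * (4 * Y * Q)\<^sup>2)"
    using Tm1 TM by algebra
  have g0: "T\<^sup>2 * (1 - k * b) * (8 * b - 4 * k * m0 - k\<^sup>2 * M) = 8 * b * T\<^sup>2 * (1 - k * b) - 4 * k * T * (1 - k * b) * (4 * Y * Q)
     - k\<^sup>2 * (4 * T * (4 * Y * P - b * (4 * Y * Q)) - 2 * (4 * Y * P)\<^sup>2 + 2 * k * (4 * Y * Q)\<^sup>2)"
    using Tm0 TM by algebra
  \<comment> \<open>Without the factors \<open>b\<^sup>3\<close> and \<open>b\<close> the weights of the squares would not be polynomials; the case \<open>b = 0\<close>,
     where they vanish, is computed directly at the end.\<close>
  have i1: "b ^ 3 * (T\<^sup>2 * (1 - k * b) * (8 - 4 * m1 - M)) = 8 * ((1 - k * b)\<^sup>2 * (1 + k * b) *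
      (b\<^sup>2 * X * (3 * (b\<^sup>2 * X) - Y - 2 * (k * b) * Y)\<^sup>2 + (k * b)\<^sup>2 * Y * (3 * (b\<^sup>2 * X) + Y)\<^sup>2))"
    unfolding g1 unfolding T_def P_def Q_def X_def Y_def by algebra
  have i0: "b * (T\<^sup>2 * (1 - k * b) * (8 * b - 4 * k * m0 - k\<^sup>2 * M)) = 8 * ((1 - k * b)\<^sup>2 * (1 + k * b) *
      (X * (3 * b * X - 2 * k * Y - k\<^sup>2 * b * Y)\<^sup>2 + Y * (3 * X + k\<^sup>2 * Y)\<^sup>2))"
    unfolding g0 unfolding T_def P_def Q_def X_def Y_def by algebra
  have n1: "0 \<le> b ^ 3 * (T\<^sup>2 * (1 - k * b) * (8 - 4 * m1 - M))"
    unfolding i1 using X0 Y0 b0 z0 kb k by (intro mult_nonneg_nonneg add_nonneg_nonneg) auto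
  have n0: "0 \<le> b * (T\<^sup>2 * (1 - k * b) * (8 * b - 4 * k * m0 - k\<^sup>2 * M))"
    unfolding i0 using X0 Y0 b0 z0 kb k by (intro mult_nonneg_nonneg add_nonneg_nonneg) auto
  have "M + 4 * m1 \<le> 8 \<and> k\<^sup>2 * M + 4 * k * m0 \<le> 8 * b"
  proof (cases "b = 0")
    case True
    then have k0: "k = 0" using k by simp
    have m1: "m1 = 4/3" using e1 True k0 by simp
    have "M = 4 * (4/3) - 2 * (4/3)\<^sup>2" using e3 True k0 m1 by simp
    then have "M = 16/9" by (simp add: power2_eq_square)
    then show ?thesis using m1 k0 True by simp
  next
    case False
    then have "0 < b" using b0 by simp
    have "0 < b ^ 3 * (T\<^sup>2 * (1 - k * b))" "0 < b * (T\<^sup>2 * (1 - k * b))"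
      using \<open>0 < b\<close> T0 kb by auto
    with n1 n0 have "0 \<le> 8 - 4 * m1 - M" "0 \<le> 8 * b - 4 * k * m0 - k\<^sup>2 * M"
      by (metis mult.assoc zero_le_mult_iff not_le)+
    then show ?thesis by simp
  qed
  then show "M + 4 * m1 \<le> 8" "k\<^sup>2 * M + 4 * k * m0 \<le> 8 * b" by auto
qed

text \<open>
  The two phases after scaling. If \<open>\<alpha>0 = k\<^sup>3 \<alpha>1\<close>, then \<open>p = w1\<close> and \<open>q = k w0\<close> satisfy \<open>\<alpha>0 cube w0 = \<alpha>1 cube q\<close>,
  so that both phases have the same coefficient, and \<open>\<Psi> \<le> 0\<close> turns into \<open>opposed\<close>.
\<close>

locale opposed_pair =
  fixes p q :: "'a::real_inner" and k :: real
  assumes p: "p \<noteq> 0" and k: "0 \<le> k" "k < 1"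
    and opposed: "(cube p - cube q) \<bullet> (k *\<^sub>R p - q) \<le> 0"
begin

definition b where "b = (q \<bullet> q) / (p \<bullet> p)"
definition c where "c = (p \<bullet> q) / (p \<bullet> p)"

lemma pp_pos: "p \<bullet> p > 0" using p by simp
lemma qq_eq: "q \<bullet> q = (p \<bullet> p) * b" using p by (simp add: b_def)
lemma pq_eq: "p \<bullet> q = (p \<bullet> p) * c" "q \<bullet> p = (p \<bullet> p) * c" using p by (simp_all add: c_def inner_commute)

lemma opposed_eq: "(cube p - cube q) \<bullet> (k *\<^sub>R p - q) = (p \<bullet> p)\<^sup>2 * (b\<^sup>2 + k - c * (1 + k * b))"
  unfolding cube_def power2_norm_eq_inner
  by (simp add: inner_diff_left inner_diff_right qq_eq pq_eq power2_eq_square algebra_simps)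

lemma gram_bounds: "k\<^sup>2 \<le> b" "b \<le> 1" "k * b < 1" "0 < (3 - k * b) * (1 - 3 * k * b) + 4 * k * c\<^sup>2"
proof -
  have "b\<^sup>2 + k \<le> c * (1 + k * b)"
    using opposed pp_pos unfolding opposed_eq by (simp add: mult_le_0_iff)
  moreover have "c\<^sup>2 \<le> b"
  proof -
    have "((p \<bullet> p) * c)\<^sup>2 \<le> (p \<bullet> p) * ((p \<bullet> p) * b)"
      using Cauchy_Schwarz_ineq[of p q] unfolding qq_eq pq_eq .
    then have "(p \<bullet> p)\<^sup>2 * c\<^sup>2 \<le> (p \<bullet> p)\<^sup>2 * b" by (simp add: power2_eq_square algebra_simps)
    then show ?thesis using pp_pos by simp
  qed
  ultimately show "k\<^sup>2 \<le> b" "b \<le> 1" "k * b < 1" "0 < (3 - k * b) * (1 - 3 * k * b) + 4 * k * c\<^sup>2"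
    using gram_region[of b k c] k by auto
qed

text \<open>
  The operator \<open>h \<longmapsto> cube_deriv p h - k cube_deriv q h\<close> is a positive multiple of the identity plus an operator with
  range in the span of \<open>p\<close> and \<open>q\<close>. It is therefore controlled by its components along \<open>p\<close>, \<open>q\<close> and
  \<open>h\<close>.
\<close>

lemma pencil_p: "(cube_deriv p h - k *\<^sub>R cube_deriv q h) \<bullet> p
    = (p \<bullet> p) * ((3 - k * b) * (h \<bullet> p) - 2 * k * c * (h \<bullet> q))"
  unfolding cube_deriv_def power2_norm_eq_inner
  by (simp add: inner_diff_left inner_add_left qq_eq pq_eq inner_commute[of p h] inner_commute[of q h] algebra_simps)

lemma pencil_q: "(cube_deriv p h - k *\<^sub>R cube_deriv q h) \<bullet> q
    = (p \<bullet> p) * (2 * c * (h \<bullet> p) + (1 - 3 * k * b) * (h \<bullet> q))"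
  unfolding cube_deriv_def power2_norm_eq_inner
  by (simp add: inner_diff_left inner_add_left qq_eq pq_eq inner_commute[of p h] inner_commute[of q h] algebra_simps)

lemma pencil_self: "(cube_deriv p h - k *\<^sub>R cube_deriv q h) \<bullet> h
    = (p \<bullet> p) * (1 - k * b) * (h \<bullet> h) + 2 * (h \<bullet> p)\<^sup>2 - 2 * k * (h \<bullet> q)\<^sup>2"
  unfolding cube_deriv_def power2_norm_eq_inner
  by (simp add: inner_diff_left inner_add_left qq_eq pq_eq inner_commute[of p h] inner_commute[of q h] power2_eq_square algebra_simps)

lemma pencil_injective:
  assumes "cube_deriv p h - k *\<^sub>R cube_deriv q h = 0"
  shows "h = 0"
proof -
  define m1 m0 where "m1 = h \<bullet> p" and "m0 = h \<bullet> q"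
  have e1: "(3 - k * b) * m1 - 2 * k * c * m0 = 0"
    using pencil_p[of h] assms pp_pos by (simp add: m1_def m0_def)
  have e2: "2 * c * m1 + (1 - 3 * k * b) * m0 = 0"
    using pencil_q[of h] assms pp_pos by (simp add: m1_def m0_def)
  define \<Delta> where "\<Delta> = (3 - k * b) * (1 - 3 * k * b) + 4 * k * c\<^sup>2"
  have "\<Delta> * m1 = 0" "\<Delta> * m0 = 0" unfolding \<Delta>_def using e1 e2 by algebra+
  moreover have "\<Delta> \<noteq> 0" unfolding \<Delta>_def using gram_bounds(4) by linarith
  ultimately have "h \<bullet> p = 0" "h \<bullet> q = 0" by (simp_all add: m1_def m0_def)
  then have "(p \<bullet> p) * (1 - k * b) * (h \<bullet> h) = 0" using pencil_self[of h] assms by simp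
  then show ?thesis using pp_pos gram_bounds(3) by simp
qed

lemma multiplier_bounds:
  assumes bal: "(cube p - cube q) \<bullet> (k *\<^sub>R p - q) = 0"
    and mult: "cube_deriv p \<mu> - k *\<^sub>R cube_deriv q \<mu> = 4 *\<^sub>R (cube p - cube q)"
  shows "(norm \<mu>)\<^sup>2 + 4 * (\<mu> \<bullet> p) \<le> 8 * (norm p)\<^sup>2"
    and "k\<^sup>2 * (norm \<mu>)\<^sup>2 + 4 * k * (\<mu> \<bullet> q) \<le> 8 * (norm q)\<^sup>2"
proof -
  define a where "a = p \<bullet> p"
  have a: "a > 0" using pp_pos by (simp add: a_def)
  define m1 m0 M where "m1 = (\<mu> \<bullet> p) / a" and "m0 = (\<mu> \<bullet> q) / a" and "M = (\<mu> \<bullet> \<mu>) / a"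
  have m: "\<mu> \<bullet> p = a * m1" "\<mu> \<bullet> q = a * m0" "\<mu> \<bullet> \<mu> = a * M"
    using a by (simp_all add: m1_def m0_def M_def)
  have rel: "c * (1 + k * b) = b\<^sup>2 + k" using bal pp_pos unfolding opposed_eq by simp
  have r1: "(4 *\<^sub>R (cube p - cube q)) \<bullet> p = a\<^sup>2 * (4 * (1 - b * c))"
    unfolding cube_def power2_norm_eq_inner a_def
    by (simp add: inner_diff_left qq_eq pq_eq power2_eq_square algebra_simps)
  have r2: "(4 *\<^sub>R (cube p - cube q)) \<bullet> q = a\<^sup>2 * (4 * (c - b\<^sup>2))"
    unfolding cube_def power2_norm_eq_inner a_def
    by (simp add: inner_diff_left qq_eq pq_eq power2_eq_square algebra_simps)
  have r3: "(4 *\<^sub>R (cube p - cube q)) \<bullet> \<mu> = a\<^sup>2 * (4 * (m1 - b * m0))"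
    unfolding cube_def power2_norm_eq_inner
    by (simp add: inner_diff_left inner_commute[of p \<mu>] inner_commute[of q \<mu>] m qq_eq a_def[symmetric] power2_eq_square algebra_simps)
  have "a\<^sup>2 * ((3 - k * b) * m1 - 2 * k * c * m0) = a\<^sup>2 * (4 * (1 - b * c))"
    using pencil_p[of \<mu>] unfolding mult r1 m a_def[symmetric] by (simp add: power2_eq_square algebra_simps)
  then have e1: "(3 - k * b) * m1 - 2 * k * c * m0 = 4 * (1 - b * c)" using a by simp
  have "a\<^sup>2 * (2 * c * m1 + (1 - 3 * k * b) * m0) = a\<^sup>2 * (4 * (c - b\<^sup>2))"
    using pencil_q[of \<mu>] unfolding mult r2 m a_def[symmetric] by (simp add: power2_eq_square algebra_simps)
  then have "2 * c * m1 + (1 - 3 * k * b) * m0 = 4 * (c - b\<^sup>2)" using a by simp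
  then have e2: "2 * c * m1 + (1 - 3 * k * b) * m0 = 4 * k * (1 - b * c)" using rel by algebra
  have "a\<^sup>2 * ((1 - k * b) * M) = a\<^sup>2 * (4 * (m1 - b * m0) - 2 * m1\<^sup>2 + 2 * k * m0\<^sup>2)"
    using pencil_self[of \<mu>] unfolding mult r3 m a_def[symmetric] by (simp add: power2_eq_square algebra_simps)
  then have e3: "(1 - k * b) * M = 4 * (m1 - b * m0) - 2 * m1\<^sup>2 + 2 * k * m0\<^sup>2" using a by simp
  note * = multiplier_bounds_normalized[OF rel e1 e2 e3 k(1) gram_bounds(1-3)]
  show "(norm \<mu>)\<^sup>2 + 4 * (\<mu> \<bullet> p) \<le> 8 * (norm p)\<^sup>2"
    using mult_left_mono[OF *(1), of a] a unfolding power2_norm_eq_inner m a_def[symmetric]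
    by (simp add: algebra_simps)
  show "k\<^sup>2 * (norm \<mu>)\<^sup>2 + 4 * k * (\<mu> \<bullet> q) \<le> 8 * (norm q)\<^sup>2"
    using mult_left_mono[OF *(2), of a] a unfolding power2_norm_eq_inner m qq_eq a_def[symmetric]
    by (simp add: algebra_simps)
qed

end

section \<open>Balanced pairs of fields and their dual certificates\<close>

lemma cube_root_ratio:
  assumes "\<alpha>0 < \<alpha>1" "0 \<le> (\<alpha>0::real)"
  obtains k where "0 \<le> k" "k < 1" "\<alpha>0 = k ^ 3 * \<alpha>1"
proof
  let ?k = "root 3 (\<alpha>0 / \<alpha>1)"
  show "0 \<le> ?k" using assms by simp
  show "?k < 1" using assms by simp
  have "?k ^ 3 = \<alpha>0 / \<alpha>1" using assms by (intro real_root_pow_pos2) auto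
  then show "\<alpha>0 = ?k ^ 3 * \<alpha>1" using assms by simp
qed

lemma opposed_pair_rescaled:
  assumes a: "\<alpha>0 < \<alpha>1" "0 \<le> \<alpha>0" "\<alpha>0 = k ^ 3 * \<alpha>1" "0 \<le> k" "k < 1"
    and w1: "w1 \<noteq> 0" and opp: "(\<alpha>1 *\<^sub>R cube w1 - \<alpha>0 *\<^sub>R cube w0) \<bullet> (w1 - w0) \<le> 0"
  shows "opposed_pair w1 (k *\<^sub>R w0) k"
proof
  have "\<alpha>1 * ((cube w1 - cube (k *\<^sub>R w0)) \<bullet> (k *\<^sub>R w1 - k *\<^sub>R w0))
     = k * ((\<alpha>1 *\<^sub>R cube w1 - \<alpha>0 *\<^sub>R cube w0) \<bullet> (w1 - w0))"
    unfolding a(3) cube_scaleR by (simp add: inner_diff_left inner_diff_right algebra_simps)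
  also have "\<dots> \<le> 0" using opp a(4) by (simp add: mult_nonneg_nonpos)
  finally show "(cube w1 - cube (k *\<^sub>R w0)) \<bullet> (k *\<^sub>R w1 - k *\<^sub>R w0) \<le> 0"
    using a by (simp add: mult_le_0_iff)
qed (use a w1 in auto)

lemma cube_deriv_scaleR: "cube_deriv (k *\<^sub>R w) h = k\<^sup>2 *\<^sub>R cube_deriv w h"
  by (simp add: cube_deriv_def power_mult_distrib scaleR_right_distrib power2_eq_square algebra_simps)

text \<open>
  After scaling, an element of the kernel is orthogonal to \<open>p\<close> and \<open>q\<close>, because the determinant in \<open>gram_region\<close> is
  positive, and on the orthogonal complement of \<open>p\<close> and \<open>q\<close> the operator is a positive multiple of the identity.
  Up to the factor \<open>- t (1 - t)\<close> the operator is the derivative of \<open>\<Phi>\<close>, and \<open>opp\<close> says that \<open>\<Psi> \<le> 0\<close>.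
\<close>

lemma pencil_bijective:
  fixes w1 w0 :: "'a::euclidean_space"
  assumes a: "\<alpha>0 < \<alpha>1" "0 \<le> \<alpha>0"
    and w1: "w1 \<noteq> 0" and opp: "(\<alpha>1 *\<^sub>R cube w1 - \<alpha>0 *\<^sub>R cube w0) \<bullet> (w1 - w0) \<le> 0"
  shows "bij (\<lambda>h. \<alpha>1 *\<^sub>R cube_deriv w1 h - \<alpha>0 *\<^sub>R cube_deriv w0 h)"
    and "linear (\<lambda>h. \<alpha>1 *\<^sub>R cube_deriv w1 h - \<alpha>0 *\<^sub>R cube_deriv w0 h)"
proof -
  let ?L = "\<lambda>h. \<alpha>1 *\<^sub>R cube_deriv w1 h - \<alpha>0 *\<^sub>R cube_deriv w0 h"
  obtain k where kr: "0 \<le> k" "k < 1" "\<alpha>0 = k ^ 3 * \<alpha>1" using cube_root_ratio[OF a] by blast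
  interpret opposed_pair w1 "k *\<^sub>R w0" k
    using opposed_pair_rescaled[OF a kr(3,1,2) w1 opp] .
  show lin: "linear ?L"
    by (intro linear_compose_sub linear_compose_scale_right linear_cube_deriv)
  have "h = 0" if "?L h = 0" for h
  proof (rule pencil_injective)
    have "\<alpha>1 *\<^sub>R (cube_deriv w1 h - k *\<^sub>R cube_deriv (k *\<^sub>R w0) h) = ?L h"
      unfolding kr(3) cube_deriv_scaleR
      by (simp add: scaleR_diff_right power2_eq_square power3_eq_cube mult_ac)
    then show "cube_deriv w1 h - k *\<^sub>R cube_deriv (k *\<^sub>R w0) h = 0"
      using that a by simp
  qed
  then have "inj ?L" using lin linear_injective_0 by blast
  then show "bij ?L" using lin by (simp add: bij_def linear_injective_imp_surjective)
qed

text \<open>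
  Equal gradients at \<open>w1\<close> and at \<open>w0\<close> mean \<open>\<kappa> = \<alpha>i (4 cube wi - cube_deriv wi \<mu>)\<close> for \<open>i = 1, 0\<close>. The two
  formulas for \<open>\<kappa>\<close> agree exactly when \<open>\<mu>\<close> solves the linear system of \<open>pencil_bijective\<close> with right-hand side
  \<open>4 (\<alpha>1 cube w1 - \<alpha>0 cube w0)\<close>, and the bounds on this \<open>\<mu>\<close> allow \<open>quartic_contact\<close> in both phases.
\<close>

lemma dual_certificate:
  fixes w1 w0 :: "'a::euclidean_space"
  assumes a: "\<alpha>0 < \<alpha>1" "0 \<le> \<alpha>0"
    and bal: "(\<alpha>1 *\<^sub>R cube w1 - \<alpha>0 *\<^sub>R cube w0) \<bullet> (w1 - w0) = 0"
  obtains \<kappa> \<mu> where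
    "\<And>u. \<kappa> \<bullet> (u - w1) + \<mu> \<bullet> (\<alpha>1 *\<^sub>R cube u - \<alpha>1 *\<^sub>R cube w1) \<le> \<alpha>1 * norm u ^ 4 - \<alpha>1 * norm w1 ^ 4"
    "\<And>u. \<kappa> \<bullet> (u - w0) + \<mu> \<bullet> (\<alpha>0 *\<^sub>R cube u - \<alpha>0 *\<^sub>R cube w0) \<le> \<alpha>0 * norm u ^ 4 - \<alpha>0 * norm w0 ^ 4"
proof (cases "w1 = 0")
  case True
  \<comment> \<open>Then both fluxes vanish, and zero is a lower bound that is attained in both phases.\<close>
  then have "\<alpha>0 * norm w0 ^ 4 = 0" using bal by (simp add: inner_cube_self inner_commute)
  then show ?thesis using a True by (intro that[of 0 0]) auto
next
  case False
  obtain k where kr: "0 \<le> k" "k < 1" "\<alpha>0 = k ^ 3 * \<alpha>1" using cube_root_ratio[OF a] by blast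
  interpret opposed_pair w1 "k *\<^sub>R w0" k
    using opposed_pair_rescaled[OF a kr(3,1,2) False] bal by simp
  have "surj (\<lambda>h. \<alpha>1 *\<^sub>R cube_deriv w1 h - \<alpha>0 *\<^sub>R cube_deriv w0 h)"
    using pencil_bijective(1)[OF a False] bal by (simp add: bij_def)
  from surjD[OF this, of "4 *\<^sub>R (\<alpha>1 *\<^sub>R cube w1 - \<alpha>0 *\<^sub>R cube w0)"]
  obtain \<mu> where \<mu>: "4 *\<^sub>R (\<alpha>1 *\<^sub>R cube w1 - \<alpha>0 *\<^sub>R cube w0)
      = \<alpha>1 *\<^sub>R cube_deriv w1 \<mu> - \<alpha>0 *\<^sub>R cube_deriv w0 \<mu>"
    by blast
  have "\<alpha>1 *\<^sub>R (cube_deriv w1 \<mu> - k *\<^sub>R cube_deriv (k *\<^sub>R w0) \<mu>)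
      = \<alpha>1 *\<^sub>R (4 *\<^sub>R (cube w1 - cube (k *\<^sub>R w0)))"
    using \<mu> unfolding kr(3) cube_deriv_scaleR cube_scaleR
    by (simp add: scaleR_diff_right power2_eq_square power3_eq_cube mult_ac)
  then have mult: "cube_deriv w1 \<mu> - k *\<^sub>R cube_deriv (k *\<^sub>R w0) \<mu> = 4 *\<^sub>R (cube w1 - cube (k *\<^sub>R w0))"
    by (rule scaleR_left_imp_eq[rotated]) (use a in simp)
  have "\<alpha>1 * ((cube w1 - cube (k *\<^sub>R w0)) \<bullet> (k *\<^sub>R w1 - k *\<^sub>R w0))
     = k * ((\<alpha>1 *\<^sub>R cube w1 - \<alpha>0 *\<^sub>R cube w0) \<bullet> (w1 - w0))"
    unfolding kr(3) cube_scaleR by (simp add: inner_diff_left inner_diff_right algebra_simps)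
  then have bal': "(cube w1 - cube (k *\<^sub>R w0)) \<bullet> (k *\<^sub>R w1 - k *\<^sub>R w0) = 0"
    using bal a by simp
  note bounds = multiplier_bounds[OF bal' mult]
  define \<kappa> where "\<kappa> = \<alpha>1 *\<^sub>R (4 *\<^sub>R cube w1 - cube_deriv w1 \<mu>)"
  have \<kappa>0: "\<kappa> = \<alpha>0 *\<^sub>R (4 *\<^sub>R cube w0 - cube_deriv w0 \<mu>)"
    using \<mu> unfolding \<kappa>_def by (simp add: scaleR_diff_right algebra_simps)
  show ?thesis
  proof
    fix u
    show "\<kappa> \<bullet> (u - w1) + \<mu> \<bullet> (\<alpha>1 *\<^sub>R cube u - \<alpha>1 *\<^sub>R cube w1) \<le> \<alpha>1 * norm u ^ 4 - \<alpha>1 * norm w1 ^ 4"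
      using mult_left_mono[OF quartic_contact[OF bounds(1), of u], of \<alpha>1] a
      unfolding \<kappa>_def scaleR_diff_right[symmetric] by (simp add: algebra_simps)
    show "\<kappa> \<bullet> (u - w0) + \<mu> \<bullet> (\<alpha>0 *\<^sub>R cube u - \<alpha>0 *\<^sub>R cube w0) \<le> \<alpha>0 * norm u ^ 4 - \<alpha>0 * norm w0 ^ 4"
    proof (cases "k = 0")
      case True
      then have "\<alpha>0 = 0" using kr by simp
      then show ?thesis unfolding \<kappa>0 by simp
    next
      case False
      have "k\<^sup>2 * ((norm \<mu>)\<^sup>2 + 4 * (\<mu> \<bullet> w0)) \<le> k\<^sup>2 * (8 * (norm w0)\<^sup>2)"
        using bounds(2) by (simp add: power_mult_distrib power2_eq_square algebra_simps)
      then have "(norm \<mu>)\<^sup>2 + 4 * (\<mu> \<bullet> w0) \<le> 8 * (norm w0)\<^sup>2" using False by simp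
      from mult_left_mono[OF quartic_contact[OF this, of u], of \<alpha>0] a
      show ?thesis
        unfolding \<kappa>0 scaleR_diff_right[symmetric] by (simp add: algebra_simps)
    qed
  qed
qed

section \<open>The image of \<open>\<Phi>\<close> and its frontier\<close>

definition field1 :: "real \<Rightarrow> 'a::real_vector \<Rightarrow> 'a \<Rightarrow> 'a" where
  "field1 t U x = U - (1 - t) *\<^sub>R x"

definition field0 :: "real \<Rightarrow> 'a::real_vector \<Rightarrow> 'a \<Rightarrow> 'a" where
  "field0 t U x = U + t *\<^sub>R x"

lemma field_mean: "t *\<^sub>R field1 t U x + (1 - t) *\<^sub>R field0 t U x = U"
  by (simp add: field1_def field0_def algebra_simps)

lemma field_jump: "field1 t U x - field0 t U x = - x"
  by (simp add: field1_def field0_def algebra_simps)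

lemma \<Psi>_eq: "\<Psi> \<alpha>1 \<alpha>0 t U x
    = (\<alpha>1 *\<^sub>R cube (field1 t U x) - \<alpha>0 *\<^sub>R cube (field0 t U x)) \<bullet> (field1 t U x - field0 t U x)"
proof -
  have "(1 - t) *\<^sub>R x - U = - field1 t U x" "t *\<^sub>R x + U = field0 t U x"
    by (simp_all add: field1_def field0_def)
  then show ?thesis unfolding field_jump \<Psi>_def
    by (simp add: cube_def inner_diff_left)
qed

lemma \<Phi>_eq: "\<Phi> \<alpha>1 \<alpha>0 t U x
    = t *\<^sub>R (\<alpha>1 *\<^sub>R cube (field1 t U x)) + (1 - t) *\<^sub>R (\<alpha>0 *\<^sub>R cube (field0 t U x))"
  by (simp add: \<Phi>_def cube_def field1_def field0_def mult.assoc)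

text \<open>
  This is \<open>t a1 + (1 - t) a0 = U \<bullet> V + t (1 - t) (w1 - w0) \<bullet> (v1 - v0)\<close> with \<open>ai = wi \<bullet> vi\<close>: the sign of \<open>\<Psi>\<close> compares the
  energy of the pair of constant fields with \<open>U \<bullet> \<Phi> x\<close>, the energy of every laminate with barycenter
  \<open>(U, \<Phi> x)\<close>.
\<close>

lemma energy_gap:
  "t * (\<alpha>1 * norm (field1 t U x) ^ 4) + (1 - t) * (\<alpha>0 * norm (field0 t U x) ^ 4)
    = U \<bullet> \<Phi> \<alpha>1 \<alpha>0 t U x + t * (1 - t) * \<Psi> \<alpha>1 \<alpha>0 t U x"
proof -
  have U1: "U = field1 t U x + (1 - t) *\<^sub>R x" and U0: "U = field0 t U x - t *\<^sub>R x"
    by (simp_all add: field1_def field0_def)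
  have "U \<bullet> \<Phi> \<alpha>1 \<alpha>0 t U x = t * \<alpha>1 * (U \<bullet> cube (field1 t U x)) + (1 - t) * \<alpha>0 * (U \<bullet> cube (field0 t U x))"
    unfolding \<Phi>_eq by (simp add: inner_add_right)
  also have "U \<bullet> cube (field1 t U x) = norm (field1 t U x) ^ 4 + (1 - t) * (x \<bullet> cube (field1 t U x))"
    by (subst (1) U1) (simp add: inner_add_left inner_cube_self)
  also have "U \<bullet> cube (field0 t U x) = norm (field0 t U x) ^ 4 - t * (x \<bullet> cube (field0 t U x))"
    by (subst (1) U0) (simp add: inner_diff_left inner_cube_self)
  finally show ?thesis
    unfolding \<Psi>_eq field_jump by (simp add: inner_diff_left inner_commute[of x] algebra_simps)
qed

lemma continuous_on_\<Psi>: "continuous_on S (\<Psi> \<alpha>1 \<alpha>0 t U)"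
  unfolding \<Psi>_def by (intro continuous_intros)

lemma continuous_on_\<Phi>: "continuous_on S (\<Phi> \<alpha>1 \<alpha>0 t U)"
  unfolding \<Phi>_def by (intro continuous_intros)

text \<open>
  Boundedness: monotonicity of \<open>cube\<close> between \<open>U\<close> and the field in each phase bounds \<open>\<Psi> x\<close> below by
  \<open>\<alpha>1 (1 - t)\<^sup>3 |x|\<^sup>4 / 4 - (\<alpha>1 - \<alpha>0) |U|\<^sup>3 |x|\<close>. The quartic term comes from the phase with coefficient \<open>\<alpha>1\<close>,
  the one that cannot degenerate.
\<close>

lemma compact_C_set:
  assumes a: "\<alpha>0 < \<alpha>1" "0 \<le> \<alpha>0" and t: "0 < t" "t < 1"
  shows "compact (C_set \<alpha>1 \<alpha>0 t U)"
proof -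
  have "closed (C_set \<alpha>1 \<alpha>0 t U)"
    unfolding C_set_def by (intro closed_Collect_le continuous_on_\<Psi> continuous_on_const)
  moreover have "norm x \<le> 2 * norm U / (1 - t)" if "x \<in> C_set \<alpha>1 \<alpha>0 t U" for x
  proof -
    let ?w1 = "field1 t U x" and ?w0 = "field0 t U x"
    have "0 \<le> norm (?w0 - U) ^ 4 / 4" by simp
    also have "\<dots> \<le> (cube ?w0 - cube U) \<bullet> (?w0 - U)" by (rule cube_monotone)
    also have "\<dots> = t * ((cube ?w0 - cube U) \<bullet> x)" by (simp add: field0_def)
    finally have m0: "cube U \<bullet> x \<le> cube ?w0 \<bullet> x" using t by (simp add: zero_le_mult_iff inner_diff_left)
    have "((1 - t) * norm x) ^ 4 / 4 = norm (U - ?w1) ^ 4 / 4" using t by (simp add: field1_def)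
    also have "\<dots> \<le> (cube U - cube ?w1) \<bullet> (U - ?w1)" by (rule cube_monotone)
    also have "\<dots> = (1 - t) * (cube U \<bullet> x - cube ?w1 \<bullet> x)" by (simp add: field1_def inner_diff_left)
    finally have "(1 - t) * ((1 - t) ^ 3 * norm x ^ 4 / 4) \<le> (1 - t) * (cube U \<bullet> x - cube ?w1 \<bullet> x)"
      by (simp add: power_mult_distrib power3_eq_cube power4_eq_xxxx mult_ac)
    then have m1: "(1 - t) ^ 3 * norm x ^ 4 / 4 \<le> cube U \<bullet> x - cube ?w1 \<bullet> x"
      using t by simp
    have "\<alpha>0 * (cube ?w0 \<bullet> x) \<le> \<alpha>1 * (cube ?w1 \<bullet> x)"
      using that unfolding C_set_def \<Psi>_eq field_jump by (simp add: inner_diff_left)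
    moreover have "\<alpha>0 * (cube U \<bullet> x) \<le> \<alpha>0 * (cube ?w0 \<bullet> x)" using m0 a by (simp add: mult_left_mono)
    moreover have "\<alpha>1 * ((1 - t) ^ 3 * norm x ^ 4 / 4) \<le> \<alpha>1 * (cube U \<bullet> x - cube ?w1 \<bullet> x)"
      using m1 a by (intro mult_left_mono) auto
    ultimately have "\<alpha>1 * ((1 - t) ^ 3 * norm x ^ 4 / 4) \<le> (\<alpha>1 - \<alpha>0) * (cube U \<bullet> x)"
      by (simp add: algebra_simps)
    also have "\<dots> \<le> (\<alpha>1 - \<alpha>0) * (norm U ^ 3 * norm x)"
      using a Cauchy_Schwarz_ineq2[of "cube U" x] by (intro mult_left_mono) (auto simp: norm_cube)
    also have "\<dots> \<le> \<alpha>1 * (norm U ^ 3 * norm x)" using a by (intro mult_right_mono) auto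
    finally have "(1 - t) ^ 3 * norm x ^ 4 / 4 \<le> norm U ^ 3 * norm x" using a by simp
    then have le: "norm x * ((1 - t) * norm x) ^ 3 \<le> norm x * (4 * norm U ^ 3)"
      by (simp add: power_mult_distrib power3_eq_cube power4_eq_xxxx algebra_simps)
    show ?thesis
    proof (cases "x = 0")
      case True
      then show ?thesis using t by simp
    next
      case False
      then have "((1 - t) * norm x) ^ 3 \<le> 4 * norm U ^ 3" using le by simp
      also have "\<dots> \<le> (2 * norm U) ^ 3" by (simp add: power_mult_distrib)
      finally have "(1 - t) * norm x \<le> 2 * norm U"
        using t by (subst (asm) power_mono_iff) auto
      then show ?thesis using t by (simp add: field_simps)
    qed
  qed
  then have "bounded (C_set \<alpha>1 \<alpha>0 t U)" by (auto simp: bounded_iff)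
  ultimately show ?thesis by (simp add: compact_eq_bounded_closed)
qed

text \<open>
  An invertible derivative makes \<open>\<Phi>\<close> open at \<open>x\<close>, and \<open>x\<close> is an interior point of \<open>C_set\<close> because \<open>\<Psi>\<close> is
  continuous.
\<close>

lemma \<Phi>_interior:
  assumes a: "\<alpha>0 < \<alpha>1" "0 \<le> \<alpha>0" and t: "0 < t" "t < 1" and x: "\<Psi> \<alpha>1 \<alpha>0 t U x < 0"
  shows "\<Phi> \<alpha>1 \<alpha>0 t U x \<in> interior (\<Phi> \<alpha>1 \<alpha>0 t U ` C_set \<alpha>1 \<alpha>0 t U)"
proof -
  let ?w1 = "field1 t U x" and ?w0 = "field0 t U x"
  let ?L = "\<lambda>h. \<alpha>1 *\<^sub>R cube_deriv ?w1 h - \<alpha>0 *\<^sub>R cube_deriv ?w0 h"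
  let ?D = "\<lambda>h. (- t * (1 - t)) *\<^sub>R ?L h"
  have w1: "?w1 \<noteq> 0"
  proof
    assume "?w1 = 0"
    then have "\<Psi> \<alpha>1 \<alpha>0 t U x = \<alpha>0 * norm ?w0 ^ 4"
      unfolding \<Psi>_eq by (simp add: inner_cube_self inner_commute)
    then show False using x mult_nonneg_nonneg[OF a(2), of "norm ?w0 ^ 4"] by simp
  qed
  note bl = pencil_bijective[OF a w1 less_imp_le[OF x[unfolded \<Psi>_eq]]]
  have linD: "linear ?D" by (intro linear_compose_scale_right bl(2))
  have "inj ?D"
  proof (rule injI)
    fix h h' assume "?D h = ?D h'"
    then have "?L h = ?L h'" by (rule scaleR_left_imp_eq[rotated]) (use t in simp)
    then show "h = h'" by (rule injD[OF bij_is_inj[OF bl(1)]])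
  qed
  then obtain g where g: "linear g" "g \<circ> ?D = id" using linD linear_injective_left_inverse by blast
  then have Dg: "?D \<circ> g = id" using linD linear_inverse_left by blast
  have eq: "\<Phi> \<alpha>1 \<alpha>0 t U = (\<lambda>x. t *\<^sub>R (\<alpha>1 *\<^sub>R cube (field1 t U x)) + (1 - t) *\<^sub>R (\<alpha>0 *\<^sub>R cube (field0 t U x)))"
    by (simp add: \<Phi>_eq fun_eq_iff)
  have d1: "((\<lambda>x. cube (field1 t U x)) has_derivative (\<lambda>h. cube_deriv ?w1 (- (1 - t) *\<^sub>R h))) (at x)"
    by (rule has_derivative_compose[OF _ has_derivative_cube])
      (auto simp: field1_def fun_eq_iff algebra_simps intro!: derivative_eq_intros)
  have d0: "((\<lambda>x. cube (field0 t U x)) has_derivative (\<lambda>h. cube_deriv ?w0 (t *\<^sub>R h))) (at x)"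
    by (rule has_derivative_compose[OF _ has_derivative_cube])
      (auto simp: field0_def intro!: derivative_eq_intros)
  have "(\<Phi> \<alpha>1 \<alpha>0 t U has_derivative (\<lambda>h. t *\<^sub>R (\<alpha>1 *\<^sub>R cube_deriv ?w1 (- (1 - t) *\<^sub>R h))
       + (1 - t) *\<^sub>R (\<alpha>0 *\<^sub>R cube_deriv ?w0 (t *\<^sub>R h)))) (at x)"
    unfolding eq by (intro has_derivative_add has_derivative_scaleR_right d1 d0)
  also have "(\<lambda>h. t *\<^sub>R (\<alpha>1 *\<^sub>R cube_deriv ?w1 (- (1 - t) *\<^sub>R h))
       + (1 - t) *\<^sub>R (\<alpha>0 *\<^sub>R cube_deriv ?w0 (t *\<^sub>R h))) = ?D"
    by (rule ext) (simp only: linear_cmul[OF linear_cube_deriv], simp add: algebra_simps)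
  finally have der: "(\<Phi> \<alpha>1 \<alpha>0 t U has_derivative ?D) (at x)" .
  have "open {y. \<Psi> \<alpha>1 \<alpha>0 t U y < 0}"
    by (intro open_Collect_less continuous_on_\<Psi> continuous_on_const)
  then have "x \<in> interior (C_set \<alpha>1 \<alpha>0 t U)"
    using x by (intro interiorI[of "{y. \<Psi> \<alpha>1 \<alpha>0 t U y < 0}"]) (auto simp: C_set_def)
  then show ?thesis
    using sussmann_open_mapping[OF open_UNIV continuous_on_\<Phi> UNIV_I der _ Dg subset_UNIV] g(1)
    by (simp add: linear_linear)
qed

lemma frontier_\<Phi>_image:
  assumes a: "\<alpha>0 < \<alpha>1" "0 \<le> \<alpha>0" and t: "0 < t" "t < 1"
    and V: "V \<in> frontier (\<Phi> \<alpha>1 \<alpha>0 t U ` C_set \<alpha>1 \<alpha>0 t U)"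
  obtains y where "\<Psi> \<alpha>1 \<alpha>0 t U y = 0" "V = \<Phi> \<alpha>1 \<alpha>0 t U y"
proof -
  have "compact (\<Phi> \<alpha>1 \<alpha>0 t U ` C_set \<alpha>1 \<alpha>0 t U)"
    by (intro compact_continuous_image continuous_on_\<Phi> compact_C_set a t)
  then have "V \<in> \<Phi> \<alpha>1 \<alpha>0 t U ` C_set \<alpha>1 \<alpha>0 t U"
    using V compact_imp_closed frontier_subset_closed by blast
  then obtain y where y: "\<Psi> \<alpha>1 \<alpha>0 t U y \<le> 0" "V = \<Phi> \<alpha>1 \<alpha>0 t U y" by (auto simp: C_set_def)
  have "V \<notin> interior (\<Phi> \<alpha>1 \<alpha>0 t U ` C_set \<alpha>1 \<alpha>0 t U)" using V by (simp add: frontier_def)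
  then have "\<not> \<Psi> \<alpha>1 \<alpha>0 t U y < 0" using \<Phi>_interior[OF a t] y(2) by blast
  then show ?thesis using y that by force
qed

section \<open>Mixtures and laminates\<close>

lemma mem_constitutive_set: "z \<in> constitutive_set \<alpha> \<longleftrightarrow> snd z = \<alpha> *\<^sub>R cube (fst z)"
  by (cases z) (simp add: constitutive_set_def cube_def)

lemma set_pmf_mixture_subset: "set_pmf (mixture r \<nu>1 \<nu>0) \<subseteq> set_pmf \<nu>1 \<union> set_pmf \<nu>0"
  by (auto simp: mixture_def split: if_splits)

lemma set_pmf_mixture: "0 < r \<Longrightarrow> r < 1 \<Longrightarrow> set_pmf (mixture r \<nu>1 \<nu>0) = set_pmf \<nu>1 \<union> set_pmf \<nu>0"
  by (auto simp: mixture_def split: if_splits)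

lemma mixture_one: "mixture 1 \<nu>1 \<nu>0 = \<nu>1"
  by (rule pmf_eqI) (simp add: pmf_mixture)

lemma mixture_zero: "mixture 0 \<nu>1 \<nu>0 = \<nu>0"
  by (rule pmf_eqI) (simp add: pmf_mixture)

text \<open>
  Splitting a mixture of two laminates into phases: this is what makes a mixture of reachable states with
  the same volume fraction \<open>t\<close> reachable with the volume fraction \<open>t\<close>.
\<close>

lemma mixture_interchange:
  assumes "0 \<le> r" "r \<le> 1" "0 \<le> t" "t \<le> 1"
  shows "mixture r (mixture t a1 a0) (mixture t b1 b0) = mixture t (mixture r a1 b1) (mixture r a0 b0)"
  by (rule pmf_eqI) (simp add: pmf_mixture assms algebra_simps)

lemma expectation_mixture:
  fixes f :: "'a \<Rightarrow> 'b::{banach, second_countable_topology}"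
  assumes "finite (set_pmf \<nu>1)" "finite (set_pmf \<nu>0)" "0 \<le> r" "r \<le> 1"
  shows "measure_pmf.expectation (mixture r \<nu>1 \<nu>0) f
    = r *\<^sub>R measure_pmf.expectation \<nu>1 f + (1 - r) *\<^sub>R measure_pmf.expectation \<nu>0 f"
proof -
  let ?A = "set_pmf \<nu>1 \<union> set_pmf \<nu>0"
  have fin: "finite ?A" using assms by simp
  have "measure_pmf.expectation (mixture r \<nu>1 \<nu>0) f = (\<Sum>z\<in>?A. pmf (mixture r \<nu>1 \<nu>0) z *\<^sub>R f z)"
    by (rule integral_measure_pmf[OF fin]) (auto dest!: subsetD[OF set_pmf_mixture_subset])
  also have "\<dots> = r *\<^sub>R (\<Sum>z\<in>?A. pmf \<nu>1 z *\<^sub>R f z) + (1 - r) *\<^sub>R (\<Sum>z\<in>?A. pmf \<nu>0 z *\<^sub>R f z)"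
    using assms by (simp add: pmf_mixture scaleR_left_distrib sum.distrib scaleR_sum_right)
  also have "(\<Sum>z\<in>?A. pmf \<nu>1 z *\<^sub>R f z) = measure_pmf.expectation \<nu>1 f"
    by (rule integral_measure_pmf[OF fin, symmetric]) simp
  also have "(\<Sum>z\<in>?A. pmf \<nu>0 z *\<^sub>R f z) = measure_pmf.expectation \<nu>0 f"
    by (rule integral_measure_pmf[OF fin, symmetric]) simp
  finally show ?thesis .
qed

lemma barycenter_mixture:
  assumes "finite (set_pmf \<nu>1)" "finite (set_pmf \<nu>0)" "0 \<le> r" "r \<le> 1"
  shows "barycenter (mixture r \<nu>1 \<nu>0) = r *\<^sub>R barycenter \<nu>1 + (1 - r) *\<^sub>R barycenter \<nu>0"
  unfolding barycenter_def by (rule expectation_mixture[OF assms])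

lemma barycenter_return: "barycenter (return_pmf z) = z"
  by (simp add: barycenter_def)

lemma expectation_inner:
  fixes \<nu> :: "'a::euclidean_space pmf"
  assumes "finite (set_pmf \<nu>)"
  shows "measure_pmf.expectation \<nu> (\<lambda>z. a \<bullet> z) = a \<bullet> barycenter \<nu>"
  unfolding barycenter_def by (intro integral_inner_right integrable_measure_pmf_finite assms)

lemma laminate_Suc: "laminate k \<nu> \<Longrightarrow> laminate (Suc k) \<nu>"
  using laminate.mix[of k \<nu> \<nu> "fst (barycenter \<nu>)" "snd (barycenter \<nu>)" "fst (barycenter \<nu>)" "snd (barycenter \<nu>)" 1]
  by (simp add: mixture_one)

lemma laminate_mono: "k \<le> l \<Longrightarrow> laminate k \<nu> \<Longrightarrow> laminate l \<nu>"
  by (induction l rule: dec_induct) (auto intro: laminate_Suc)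

text \<open>
  In a mixture, the product of the barycenters differs from the mixture of the products by
  \<open>r (1 - r) (A1 - A0) \<bullet> (B1 - B0)\<close>, and this vanishes by compatibility.
\<close>

lemma laminate_div_curl:
  "laminate k \<nu> \<Longrightarrow> measure_pmf.expectation \<nu> (\<lambda>z. fst z \<bullet> snd z) = fst (barycenter \<nu>) \<bullet> snd (barycenter \<nu>)"
proof (induction rule: laminate.induct)
  case (dirac z)
  then show ?case by (simp add: barycenter_return)
next
  case (mix k \<nu>1 \<nu>0 A1 B1 A0 B0 r)
  have fin: "finite (set_pmf \<nu>1)" "finite (set_pmf \<nu>0)"
    using mix finite_set_pmf_laminate by blast+
  have "A1 \<bullet> B0 + A0 \<bullet> B1 = A1 \<bullet> B1 + A0 \<bullet> B0"
    using mix(5) by (simp add: inner_diff_left inner_diff_right)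
  then have "r * (1 - r) * (A1 \<bullet> B0 + A0 \<bullet> B1) = r * (1 - r) * (A1 \<bullet> B1 + A0 \<bullet> B0)" by simp
  then show ?case
    unfolding expectation_mixture[OF fin mix(6,7)] barycenter_mixture[OF fin mix(6,7)]
    using mix by (simp add: inner_add_left inner_add_right algebra_simps)
qed

text \<open>
  By \<open>laminate_div_curl\<close> the expectation of \<open>(u - U) \<bullet> (v - W)\<close> is \<open>U \<bullet> V - U \<bullet> W - U \<bullet> V + U \<bullet> W = 0\<close>, so this
  product vanishes on the support as soon as it is nonnegative there.
\<close>

lemma laminate_rigidity:
  fixes \<nu> :: "((real ^ 'n) \<times> (real ^ 'n)) pmf"
  assumes lam: "laminate k \<nu>" and bary: "barycenter \<nu> = (U, V)"
    and mon: "\<And>u v. (u, v) \<in> set_pmf \<nu> \<Longrightarrow> 0 \<le> (u - U) \<bullet> (v - W)"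
    and rig: "\<And>u v. (u, v) \<in> set_pmf \<nu> \<Longrightarrow> (u - U) \<bullet> (v - W) = 0 \<Longrightarrow> v = W"
  shows "V = W"
proof -
  note fin = finite_set_pmf_laminate[OF lam]
  let ?E = "measure_pmf.expectation \<nu>"
  let ?f = "\<lambda>z. (fst z - U) \<bullet> (snd z - W)"
  have int: "integrable (measure_pmf \<nu>) g" for g :: "_ \<Rightarrow> real"
    by (rule integrable_measure_pmf_finite[OF fin])
  have "?E ?f = ?E (\<lambda>z. fst z \<bullet> snd z - (W, U) \<bullet> z + U \<bullet> W)"
    by (intro Bochner_Integration.integral_cong refl)
      (auto simp: inner_diff_left inner_diff_right inner_commute inner_prod_def)
  also have "\<dots> = ?E (\<lambda>z. fst z \<bullet> snd z) - ?E (\<lambda>z. (W, U) \<bullet> z) + U \<bullet> W"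
    by (simp add: int)
  also have "\<dots> = 0"
    unfolding laminate_div_curl[OF lam] expectation_inner[OF fin] bary by (simp add: inner_commute)
  finally have "?E ?f = 0" .
  moreover have "AE z in measure_pmf \<nu>. 0 \<le> ?f z"
    using mon by (auto simp: AE_measure_pmf_iff)
  ultimately have "AE z in measure_pmf \<nu>. ?f z = 0"
    by (simp only: integral_nonneg_eq_0_iff_AE[OF int])
  then have "\<And>z. z \<in> set_pmf \<nu> \<Longrightarrow> snd z = W"
    using rig by (auto simp: AE_measure_pmf_iff)
  then have "?E (\<lambda>z. (0, V - W) \<bullet> z) = ?E (\<lambda>z. (V - W) \<bullet> W)"
    by (intro integral_cong_AE) (auto simp: AE_measure_pmf_iff inner_prod_def)
  then have "(V - W) \<bullet> (V - W) = 0"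
    unfolding expectation_inner[OF fin] bary by (simp add: inner_diff_right)
  then show ?thesis by simp
qed

text \<open>
  The constant field \<open>U\<close> has the same flux \<open>W\<close> in every phase that is present, and strict monotonicity leaves no other
  flux. This happens when a single phase is present, and when \<open>U = 0\<close>.
\<close>

lemma phase_rigidity:
  fixes \<nu> :: "((real ^ 'n) \<times> (real ^ 'n)) pmf"
  assumes lam: "laminate k \<nu>" and bary: "barycenter \<nu> = (U, V)"
    and phase: "\<And>z. z \<in> set_pmf \<nu> \<Longrightarrow> \<exists>\<alpha>\<ge>0. z \<in> constitutive_set \<alpha> \<and> \<alpha> *\<^sub>R cube U = W"
  shows "V = W"
proof (rule laminate_rigidity[OF lam bary])
  fix u v assume "(u, v) \<in> set_pmf \<nu>"
  then obtain \<alpha> where \<alpha>: "0 \<le> \<alpha>" "v = \<alpha> *\<^sub>R cube u" "W = \<alpha> *\<^sub>R cube U"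
    using phase[of "(u, v)"] by (auto simp: mem_constitutive_set)
  have le: "\<alpha> * (norm (u - U) ^ 4 / 4) \<le> (u - U) \<bullet> (v - W)"
    using mult_left_mono[OF cube_monotone \<alpha>(1), of u U] \<alpha>
    by (simp add: inner_commute flip: scaleR_diff_right)
  then show "0 \<le> (u - U) \<bullet> (v - W)" using \<alpha>(1) by (smt (verit) divide_nonneg_nonneg mult_nonneg_nonneg norm_ge_zero zero_le_power)
  show "v = W" if "(u - U) \<bullet> (v - W) = 0"
  proof (cases "\<alpha> = 0")
    case False
    then have "norm (u - U) ^ 4 \<le> 0" using le that \<alpha>(1) by (simp add: mult_le_0_iff)
    then have "u = U" using zero_le_power[of "norm (u - U)" 4] by (simp add: order_antisym_conv)
    then show ?thesis using \<alpha> by simp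
  qed (use \<alpha> in simp)
qed

section \<open>Necessity\<close>

text \<open>
  Lower bounds for \<open>u \<bullet> v\<close> with the same linear part in both phases survive averaging, because only the overall barycenter
  is prescribed.
\<close>

lemma laminate_affine_bound:
  fixes \<nu>1 \<nu>0 :: "((real ^ 'n) \<times> (real ^ 'n)) pmf"
  assumes lam: "laminate k (mixture t \<nu>1 \<nu>0)" and bary: "barycenter (mixture t \<nu>1 \<nu>0) = (U, V)"
    and t: "0 < t" "t < 1"
    and b1: "\<And>u v. (u, v) \<in> set_pmf \<nu>1 \<Longrightarrow> c1 + \<kappa> \<bullet> u + \<mu> \<bullet> v \<le> u \<bullet> v"
    and b0: "\<And>u v. (u, v) \<in> set_pmf \<nu>0 \<Longrightarrow> c0 + \<kappa> \<bullet> u + \<mu> \<bullet> v \<le> u \<bullet> v"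
  shows "t * c1 + (1 - t) * c0 + \<kappa> \<bullet> U + \<mu> \<bullet> V \<le> U \<bullet> V"
proof -
  have fin: "finite (set_pmf \<nu>1)" "finite (set_pmf \<nu>0)"
    using finite_set_pmf_laminate[OF lam] by (auto simp: set_pmf_mixture t)
  have t': "0 \<le> t" "t \<le> 1" "0 \<le> 1 - t" using t by auto
  have phase: "c + (\<kappa>, \<mu>) \<bullet> barycenter \<nu> \<le> measure_pmf.expectation \<nu> (\<lambda>z. fst z \<bullet> snd z)"
    if "finite (set_pmf \<nu>)" "\<And>u v. (u, v) \<in> set_pmf \<nu> \<Longrightarrow> c + \<kappa> \<bullet> u + \<mu> \<bullet> v \<le> u \<bullet> v" for \<nu> c
  proof -
    have int: "integrable (measure_pmf \<nu>) g" for g :: "_ \<Rightarrow> real"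
      by (rule integrable_measure_pmf_finite[OF that(1)])
    have "c + (\<kappa>, \<mu>) \<bullet> barycenter \<nu> = measure_pmf.expectation \<nu> (\<lambda>z. c + (\<kappa>, \<mu>) \<bullet> z)"
      by (simp add: int expectation_inner[OF that(1)])
    also have "\<dots> \<le> measure_pmf.expectation \<nu> (\<lambda>z. fst z \<bullet> snd z)"
      using that(2) by (intro integral_mono_AE int) (auto simp: AE_measure_pmf_iff inner_prod_def add.assoc)
    finally show ?thesis .
  qed
  have "t * c1 + (1 - t) * c0 + (\<kappa>, \<mu>) \<bullet> (U, V)
      = t * (c1 + (\<kappa>, \<mu>) \<bullet> barycenter \<nu>1) + (1 - t) * (c0 + (\<kappa>, \<mu>) \<bullet> barycenter \<nu>0)"
    unfolding bary[symmetric] barycenter_mixture[OF fin t'(1,2)] by (simp add: inner_add_right algebra_simps)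
  also have "\<dots> \<le> measure_pmf.expectation (mixture t \<nu>1 \<nu>0) (\<lambda>z. fst z \<bullet> snd z)"
    unfolding expectation_mixture[OF fin t'(1,2)] real_scaleR_def
    using phase[OF fin(1) b1] phase[OF fin(2) b0] t' by (intro add_mono mult_left_mono) auto
  also have "\<dots> = U \<bullet> V" unfolding laminate_div_curl[OF lam] bary by simp
  finally show ?thesis by (simp add: inner_prod_def add.assoc)
qed

text \<open>
  For \<open>y = \<epsilon> U\<close> the fields are \<open>s1 U\<close> and \<open>s0 U\<close>, and \<open>\<Psi> y\<close> has the sign of \<open>\<alpha>0 s0\<^sup>3 - \<alpha>1 s1\<^sup>3\<close>. Since
  \<open>\<alpha>0 < \<alpha>1\<close>, this is negative if \<open>\<epsilon>\<close> is so small that \<open>k s0 < s1\<close>.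
\<close>

lemma \<Psi>_negative_exists:
  assumes a: "\<alpha>0 < \<alpha>1" "0 \<le> \<alpha>0" and t: "0 < t" "t < 1" and U: "U \<noteq> 0"
  obtains y where "\<Psi> \<alpha>1 \<alpha>0 t U y < 0"
proof -
  obtain k where k: "0 \<le> k" "k < 1" "\<alpha>0 = k ^ 3 * \<alpha>1" using cube_root_ratio[OF a] by blast
  define \<epsilon> where "\<epsilon> = (1 - k) / 2"
  define s1 where "s1 = 1 - (1 - t) * \<epsilon>"
  define s0 where "s0 = 1 + t * \<epsilon>"
  have \<epsilon>: "0 < \<epsilon>" using k by (simp add: \<epsilon>_def)
  have "k * t * \<epsilon> + (1 - t) * \<epsilon> \<le> t * \<epsilon> + (1 - t) * \<epsilon>"
    using k t \<epsilon> by (intro add_right_mono mult_right_mono) auto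
  also have "\<dots> < 1 - k" using k by (simp add: \<epsilon>_def field_simps)
  finally have "k * s0 < s1" by (simp add: s0_def s1_def algebra_simps)
  moreover have "0 \<le> k * s0" using k t \<epsilon> by (simp add: s0_def)
  ultimately have "(k * s0) ^ 3 < s1 ^ 3" by (intro power_strict_mono) auto
  then have "\<alpha>1 * (k * s0) ^ 3 < \<alpha>1 * s1 ^ 3" using a by simp
  then have lt: "\<alpha>0 * s0 ^ 3 < \<alpha>1 * s1 ^ 3" unfolding k(3) by (simp add: power_mult_distrib mult_ac)
  have f: "field1 t U (\<epsilon> *\<^sub>R U) = s1 *\<^sub>R U" "field0 t U (\<epsilon> *\<^sub>R U) = s0 *\<^sub>R U"
    by (simp_all add: field1_def field0_def s1_def s0_def algebra_simps)
  have "\<Psi> \<alpha>1 \<alpha>0 t U (\<epsilon> *\<^sub>R U) = - \<epsilon> * ((\<alpha>1 * s1 ^ 3 - \<alpha>0 * s0 ^ 3) * norm U ^ 4)"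
    unfolding \<Psi>_eq field_jump unfolding f
    by (simp add: cube_scaleR inner_diff_left inner_commute[of "cube U"] inner_cube_self algebra_simps)
  also have "\<dots> < 0" using lt \<epsilon> U by simp
  finally show ?thesis using that by blast
qed

lemma reachable_imp_image:
  assumes a: "\<alpha>0 < \<alpha>1" "0 \<le> \<alpha>0" and t: "0 \<le> t" "t \<le> 1"
    and reach: "reachable_by_lamination \<alpha>1 \<alpha>0 t U V"
  shows "V \<in> \<Phi> \<alpha>1 \<alpha>0 t U ` C_set \<alpha>1 \<alpha>0 t U"
proof -
  obtain \<nu>1 \<nu>0 k where lam: "laminate k (mixture t \<nu>1 \<nu>0)" and bary: "barycenter (mixture t \<nu>1 \<nu>0) = (U, V)"
    and s: "set_pmf \<nu>1 \<subseteq> constitutive_set \<alpha>1" "set_pmf \<nu>0 \<subseteq> constitutive_set \<alpha>0"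
    using reach unfolding reachable_by_lamination_def by blast
  let ?K = "\<Phi> \<alpha>1 \<alpha>0 t U ` C_set \<alpha>1 \<alpha>0 t U"
  have "0 \<in> C_set \<alpha>1 \<alpha>0 t U" by (simp add: C_set_def \<Psi>_def)
  then have zero: "t *\<^sub>R (\<alpha>1 *\<^sub>R cube U) + (1 - t) *\<^sub>R (\<alpha>0 *\<^sub>R cube U) \<in> ?K"
    using \<Phi>_eq[of \<alpha>1 \<alpha>0 t U 0] by (force simp: field1_def field0_def)
  show ?thesis
  proof (cases "t = 1 \<or> t = 0 \<or> U = 0")
    case True
    have "V = t *\<^sub>R (\<alpha>1 *\<^sub>R cube U) + (1 - t) *\<^sub>R (\<alpha>0 *\<^sub>R cube U)"
    proof (rule phase_rigidity[OF lam bary])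
      fix z assume z: "z \<in> set_pmf (mixture t \<nu>1 \<nu>0)"
      have "0 \<le> \<alpha>1" using a by simp
      consider "t = 1" | "t = 0" | "U = 0" using True by blast
      then show "\<exists>\<alpha>\<ge>0. z \<in> constitutive_set \<alpha> \<and> \<alpha> *\<^sub>R cube U = t *\<^sub>R (\<alpha>1 *\<^sub>R cube U) + (1 - t) *\<^sub>R (\<alpha>0 *\<^sub>R cube U)"
      proof cases
        case 1
        then show ?thesis using z s \<open>0 \<le> \<alpha>1\<close> by (intro exI[of _ \<alpha>1]) (auto simp: mixture_one)
      next
        case 2
        then show ?thesis using z s a by (intro exI[of _ \<alpha>0]) (auto simp: mixture_zero)
      next
        case 3
        have "z \<in> constitutive_set \<alpha>1 \<or> z \<in> constitutive_set \<alpha>0"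
          using z s by (auto dest!: subsetD[OF set_pmf_mixture_subset])
        then have "\<exists>\<alpha>\<ge>0. z \<in> constitutive_set \<alpha>" using a(2) \<open>0 \<le> \<alpha>1\<close> by blast
        then show ?thesis using 3 by simp
      qed
    qed
    then show ?thesis using zero by simp
  next
    case False
    then have t: "0 < t" "t < 1" and U: "U \<noteq> 0" using t by auto
    show ?thesis
    proof (rule ccontr)
      assume V: "V \<notin> ?K"
      \<comment> \<open>Join a point of \<open>?K\<close> with negative \<open>\<Psi>\<close> to \<open>V\<close>; the segment leaves \<open>?K\<close> at a balanced pair \<open>y\<close>.\<close>
      obtain x where x: "\<Psi> \<alpha>1 \<alpha>0 t U x < 0" using \<Psi>_negative_exists[OF a t U] .
      let ?V0 = "\<Phi> \<alpha>1 \<alpha>0 t U x"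
      have "?V0 \<in> ?K" using x by (auto simp: C_set_def)
      then have "closed_segment ?V0 V \<inter> frontier ?K \<noteq> {}"
        using V by (intro connected_Int_frontier connected_segment) auto
      then obtain Vs where Vs: "Vs \<in> closed_segment ?V0 V" "Vs \<in> frontier ?K" by blast
      obtain y where y: "\<Psi> \<alpha>1 \<alpha>0 t U y = 0" "Vs = \<Phi> \<alpha>1 \<alpha>0 t U y"
        using frontier_\<Phi>_image[OF a t Vs(2)] .
      have "Vs \<noteq> V" using V y by (auto simp: C_set_def)
      moreover obtain r where r01: "0 \<le> r" "r \<le> 1" and rV: "Vs = (1 - r) *\<^sub>R ?V0 + r *\<^sub>R V"
        using Vs(1) by (auto simp: closed_segment_def)
      ultimately have "r \<noteq> 1" by auto
      with r01 rV have r: "0 \<le> r" "r < 1" "Vs = (1 - r) *\<^sub>R ?V0 + r *\<^sub>R V" by auto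
      let ?w1 = "field1 t U y" and ?w0 = "field0 t U y"
      obtain \<kappa> \<mu> where
        c1: "\<And>u. \<kappa> \<bullet> (u - ?w1) + \<mu> \<bullet> (\<alpha>1 *\<^sub>R cube u - \<alpha>1 *\<^sub>R cube ?w1) \<le> \<alpha>1 * norm u ^ 4 - \<alpha>1 * norm ?w1 ^ 4" and
        c0: "\<And>u. \<kappa> \<bullet> (u - ?w0) + \<mu> \<bullet> (\<alpha>0 *\<^sub>R cube u - \<alpha>0 *\<^sub>R cube ?w0) \<le> \<alpha>0 * norm u ^ 4 - \<alpha>0 * norm ?w0 ^ 4"
        using dual_certificate[OF a y(1)[unfolded \<Psi>_eq]] by blast
      define d1 where "d1 = \<alpha>1 * norm ?w1 ^ 4 - \<kappa> \<bullet> ?w1 - \<mu> \<bullet> (\<alpha>1 *\<^sub>R cube ?w1)"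
      define d0 where "d0 = \<alpha>0 * norm ?w0 ^ 4 - \<kappa> \<bullet> ?w0 - \<mu> \<bullet> (\<alpha>0 *\<^sub>R cube ?w0)"
      have m1: "d1 + \<kappa> \<bullet> u + \<mu> \<bullet> (\<alpha>1 *\<^sub>R cube u) \<le> \<alpha>1 * norm u ^ 4" for u
        using c1[of u] by (simp add: d1_def inner_diff_right)
      have m0: "d0 + \<kappa> \<bullet> u + \<mu> \<bullet> (\<alpha>0 *\<^sub>R cube u) \<le> \<alpha>0 * norm u ^ 4" for u
        using c0[of u] by (simp add: d0_def inner_diff_right)
      \<comment> \<open>The affine function \<open>D + \<mu> \<bullet> v - U \<bullet> v\<close> of \<open>v\<close> is negative at \<open>?V0\<close>, nonpositive at \<open>V\<close> and
         zero at \<open>Vs\<close>, which lies between them and differs from \<open>V\<close>.\<close>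
      define D where "D = t * d1 + (1 - t) * d0 + \<kappa> \<bullet> U"
      have mean: "D + \<mu> \<bullet> \<Phi> \<alpha>1 \<alpha>0 t U z = t * (d1 + \<kappa> \<bullet> field1 t U z + \<mu> \<bullet> (\<alpha>1 *\<^sub>R cube (field1 t U z)))
          + (1 - t) * (d0 + \<kappa> \<bullet> field0 t U z + \<mu> \<bullet> (\<alpha>0 *\<^sub>R cube (field0 t U z)))" for z
      proof -
        have "\<kappa> \<bullet> U = t * (\<kappa> \<bullet> field1 t U z) + (1 - t) * (\<kappa> \<bullet> field0 t U z)"
          using arg_cong[OF field_mean[of t U z], of "\<lambda>w. \<kappa> \<bullet> w"] by (simp add: inner_add_right)
        then show ?thesis unfolding D_def \<Phi>_eq by (simp add: inner_add_right algebra_simps)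
      qed
      have "D + \<mu> \<bullet> ?V0 \<le> t * (\<alpha>1 * norm (field1 t U x) ^ 4) + (1 - t) * (\<alpha>0 * norm (field0 t U x) ^ 4)"
        unfolding mean using t by (intro add_mono mult_left_mono m1 m0) auto
      also have "\<dots> < U \<bullet> ?V0"
        unfolding energy_gap using x t by (simp add: mult_pos_neg)
      finally have V0: "D + \<mu> \<bullet> ?V0 < U \<bullet> ?V0" .
      have V1: "D + \<mu> \<bullet> V \<le> U \<bullet> V"
        unfolding D_def
      proof (rule laminate_affine_bound[OF lam bary t])
        fix u v
        show "d1 + \<kappa> \<bullet> u + \<mu> \<bullet> v \<le> u \<bullet> v" if "(u, v) \<in> set_pmf \<nu>1"
          using that s(1) m1[of u] by (auto simp: mem_constitutive_set inner_cube_self dest!: subsetD)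
        show "d0 + \<kappa> \<bullet> u + \<mu> \<bullet> v \<le> u \<bullet> v" if "(u, v) \<in> set_pmf \<nu>0"
          using that s(2) m0[of u] by (auto simp: mem_constitutive_set inner_cube_self dest!: subsetD)
      qed
      have "D + \<mu> \<bullet> Vs = U \<bullet> Vs"
        using energy_gap[of t \<alpha>1 U y \<alpha>0] unfolding y(2) mean y(1) by (simp add: d1_def d0_def)
      moreover have "D + \<mu> \<bullet> Vs = (1 - r) * (D + \<mu> \<bullet> ?V0) + r * (D + \<mu> \<bullet> V)"
        unfolding r(3) by (simp add: inner_add_right algebra_simps)
      moreover have "U \<bullet> Vs = (1 - r) * (U \<bullet> ?V0) + r * (U \<bullet> V)"
        unfolding r(3) by (simp add: inner_add_right)
      moreover have "(1 - r) * (D + \<mu> \<bullet> ?V0) + r * (D + \<mu> \<bullet> V) < (1 - r) * (U \<bullet> ?V0) + r * (U \<bullet> V)"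
        using V0 V1 r by (intro add_less_le_mono mult_strict_left_mono mult_left_mono) auto
      ultimately show False by simp
    qed
  qed
qed

section \<open>Sufficiency\<close>

lemma reachable_order_one:
  assumes t: "0 \<le> t" "t \<le> 1" and y: "\<Psi> \<alpha>1 \<alpha>0 t U y = 0"
  shows "reachable_by_lamination \<alpha>1 \<alpha>0 t U (\<Phi> \<alpha>1 \<alpha>0 t U y)"
proof -
  let ?w1 = "field1 t U y" and ?w0 = "field0 t U y"
  let ?\<nu>1 = "return_pmf (?w1, \<alpha>1 *\<^sub>R cube ?w1)" and ?\<nu>0 = "return_pmf (?w0, \<alpha>0 *\<^sub>R cube ?w0)"
  have "laminate (Suc 0) (mixture t ?\<nu>1 ?\<nu>0)"
    using y t unfolding \<Psi>_eq
    by (intro laminate.mix laminate.dirac) (auto simp: barycenter_return inner_commute)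
  moreover have "barycenter (mixture t ?\<nu>1 ?\<nu>0) = (U, \<Phi> \<alpha>1 \<alpha>0 t U y)"
    using t by (simp add: barycenter_mixture barycenter_return \<Phi>_eq field_mean)
  ultimately show ?thesis
    unfolding reachable_by_lamination_def using t by (force simp: mem_constitutive_set)
qed

text \<open>
  Two laminates with the same first moment \<open>U\<close> are always compatible, since \<open>A1 - A0 = 0\<close>.
\<close>

lemma reachable_convex:
  fixes U :: "real ^ 'n"
  assumes "reachable_by_lamination \<alpha>1 \<alpha>0 t U V" "reachable_by_lamination \<alpha>1 \<alpha>0 t U W"
    and r: "0 \<le> r" "r \<le> 1"
  shows "reachable_by_lamination \<alpha>1 \<alpha>0 t U (r *\<^sub>R V + (1 - r) *\<^sub>R W)"
proof -
  obtain a1 a0 j where a: "laminate j (mixture t a1 a0)" "barycenter (mixture t a1 a0) = (U, V)"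
    "set_pmf a1 \<subseteq> constitutive_set \<alpha>1" "set_pmf a0 \<subseteq> constitutive_set \<alpha>0"
    using assms(1) unfolding reachable_by_lamination_def by blast
  obtain b1 b0 l where b: "laminate l (mixture t b1 b0)" "barycenter (mixture t b1 b0) = (U, W)"
    "set_pmf b1 \<subseteq> constitutive_set \<alpha>1" "set_pmf b0 \<subseteq> constitutive_set \<alpha>0"
    using assms(2) unfolding reachable_by_lamination_def by blast
  have t: "0 \<le> t" "t \<le> 1" using assms(1) by (simp_all add: reachable_by_lamination_def)
  let ?\<nu> = "mixture r (mixture t a1 a0) (mixture t b1 b0)"
  have "laminate (Suc (max j l)) ?\<nu>"
    using r by (intro laminate.mix[OF _ _ a(2) b(2)] laminate_mono[OF _ a(1)] laminate_mono[OF _ b(1)]) auto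
  moreover have "barycenter ?\<nu> = (U, r *\<^sub>R V + (1 - r) *\<^sub>R W)"
    using r a(2) b(2) finite_set_pmf_laminate[OF a(1)] finite_set_pmf_laminate[OF b(1)]
    by (simp add: barycenter_mixture flip: scaleR_left_distrib)
  moreover have "set_pmf (mixture r a1 b1) \<subseteq> constitutive_set \<alpha>1" "set_pmf (mixture r a0 b0) \<subseteq> constitutive_set \<alpha>0"
    using set_pmf_mixture_subset[of r a1 b1] set_pmf_mixture_subset[of r a0 b0] a b by auto
  ultimately show ?thesis
    unfolding reachable_by_lamination_def mixture_interchange[OF r t] using t by blast
qed

lemma image_imp_reachable:
  fixes U V :: "real ^ 'n"
  assumes a: "\<alpha>0 < \<alpha>1" "0 \<le> \<alpha>0" and t: "0 \<le> t" "t \<le> 1"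
    and V: "V \<in> \<Phi> \<alpha>1 \<alpha>0 t U ` C_set \<alpha>1 \<alpha>0 t U"
  shows "reachable_by_lamination \<alpha>1 \<alpha>0 t U V"
proof (cases "t = 0 \<or> t = 1")
  case True
  then have "V = \<Phi> \<alpha>1 \<alpha>0 t U 0" using V by (auto simp: \<Phi>_def)
  then show ?thesis using reachable_order_one[OF t, of \<alpha>1 \<alpha>0 U 0] by (simp add: \<Psi>_def)
next
  case False
  let ?K = "\<Phi> \<alpha>1 \<alpha>0 t U ` C_set \<alpha>1 \<alpha>0 t U"
  have t': "0 < t" "t < 1" using t False by auto
  have frontier: "reachable_by_lamination \<alpha>1 \<alpha>0 t U W" if "W \<in> frontier ?K" for W
    using frontier_\<Phi>_image[OF a t' that] reachable_order_one[OF t] by metis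
  show ?thesis
  proof (cases "V \<in> interior ?K")
    case False
    then have "V \<in> frontier ?K" using subsetD[OF closure_subset V] by (simp add: frontier_def)
    then show ?thesis by (rule frontier)
  next
    case True
    have bdd: "bounded ?K"
      by (intro compact_imp_bounded compact_continuous_image continuous_on_\<Phi> compact_C_set a t')
    obtain e :: "real ^ 'n" where e: "e \<noteq> 0" by (metis zero_neq_one)
    obtain d where d: "0 < d" "V + d *\<^sub>R e \<in> frontier ?K"
      using ray_to_frontier[OF bdd True e] by blast
    obtain d' where d': "0 < d'" "V + d' *\<^sub>R (- e) \<in> frontier ?K"
      using ray_to_frontier[OF bdd True, of "- e"] e by auto
    define r where "r = d' / (d + d')"
    have r: "0 \<le> r" "r \<le> 1" using d d' by (simp_all add: r_def)
    have "r * d - (1 - r) * d' = 0" using d d' by (simp add: r_def field_simps)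
    then have "r *\<^sub>R (V + d *\<^sub>R e) + (1 - r) *\<^sub>R (V + d' *\<^sub>R (- e)) = V + 0 *\<^sub>R e"
      by (simp only: \<open>r * d - (1 - r) * d' = 0\<close>[symmetric]) (simp add: algebra_simps)
    then show ?thesis using reachable_convex[OF frontier[OF d(2)] frontier[OF d'(2)] r] by simp
  qed
qed

theorem theorem2:
  fixes \<alpha>1 \<alpha>0 t :: real and U V :: "real ^ 'n"
  assumes "\<alpha>1 > \<alpha>0" and "\<alpha>0 \<ge> 0" and "0 \<le> t" and "t \<le> 1"
  shows "reachable_by_lamination \<alpha>1 \<alpha>0 t U V \<longleftrightarrow> V \<in> \<Phi> \<alpha>1 \<alpha>0 t U ` C_set \<alpha>1 \<alpha>0 t U"
  using reachable_imp_image image_imp_reachable assms by blast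

end
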